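(* Let $d\ge3$ and let $\Sigma$ be a symmetric positive definite $d\times d$ matrix. For $\mu_1,\mu_{-1}\in\mathbb{R}^d$, consider $(X,M,Y)$ with values in $\mathbb{R}^d\times\{0,1\}^d\times\{-1,1\}$ such that $\mathbb{P}(Y=1)=\mathbb{P}(Y=-1)$, $X|Y=k\sim\mathcal{N}(\mu_k,\Sigma)$ for $k\in\{-1,1\}$, and $M$ is independent of $(X,Y)$. Then constant imputation is Bayes optimal for all values of $\mu_{-1}$ and $\mu_1$ if and only if $\Sigma$ is diagonal. In this case, the optimal imputation is given by $\alpha_j=(\mu_{1,j}+\mu_{-1,j})/2$ for all $1\le j\le d$.
   Context: $M_j=1$ means that $X_j$ is missing; $\mathrm{obs}(m)=\{j:m_j=0\}$; $X_{\mathrm{obs}(m)}$ is the subvector of $X$ indexed by $\mathrm{obs}(m)$; $Z=(X_{\mathrm{obs}(M)},M)$. Convention: $\mathrm{sign}(x)=1$ if $x\ge 0$, $-1$ otherwise. For a $\{-1,1\}$-valued classifier $h$, $\mathcal{R}_{\mathrm{mis}}(h)=\mathbb{P}(Y\ne h(Z))$; $h$ is Bayes optimal if $\mathcal{R}_{\mathrm{mis}}(h)=\mathcal{R}_{\mathrm{mis}}(h^\star_{\mathrm{mis}})$ where $h^\star_{\mathrm{mis}}(Z)=\mathrm{sign}(\mathbb{E}[Y|Z])$. "Constant imputation is Bayes optimal" (for given $\mu_{\pm1},\Sigma$) means that there exist imputation constants $\alpha\in\mathbb{R}^d$ and coefficients $\gamma_0,\dots,\gamma_d\in\mathbb{R}$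 (possibly depending on $\mu_{\pm1},\Sigma$) such that the linear classifier applied to the imputed data, $h_{\mathrm{imp}}(Z)=\mathrm{sign}\big(\gamma_0+\sum_{j=1}^d\gamma_j(X_j\mathbf{1}_{M_j=0}+\alpha_j\mathbf{1}_{M_j=1})\big)$, is Bayes optimal. "The optimal imputation is given by $\alpha$" means that with this $\alpha$ (and suitable $\gamma_0,\dots,\gamma_d$) $h_{\mathrm{imp}}$ is Bayes optimal. *)

theory Defs
  imports "HOL-Probability.Probability"
begin

text \<open>
  A mask \<open>m :: bool^'d\<close> encodes an element of \<open>{0,1}^d\<close>: \<open>m $ j\<close> holds iff the \<open>j\<close>-th
  coordinate is missing.
\<close>

definition obs :: "bool^'d \<Rightarrow> 'd set" where
  "obs m = {j. \<not> m $ j}"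

text \<open>
  The pair \<open>Z = (X\<^sub>o\<^sub>b\<^sub>s\<^sub>(\<^sub>M\<^sub>), M)\<close>. The subvector, whose dimension depends on the mask, is the
  restriction of the coordinate function to \<^term>\<open>obs m\<close>; it has the fixed value
  \<^const>\<open>undefined\<close> at missing coordinates, so it carries no information about them. Thus all
  values of \<open>Z\<close> lie in one measurable space.
\<close>

type_synonym 'd observation = "('d \<Rightarrow> real) \<times> (bool^'d)"

definition observe :: "real^'d \<Rightarrow> bool^'d \<Rightarrow> 'd observation" where
  "observe x m = (restrict (\<lambda>j. x $ j) (obs m), m)"

definition observation_space :: "('d::finite) observation measure" where
  "observation_space = (Pi\<^sub>M UNIV (\<lambda>_. borel)) \<Otimes>\<^sub>M count_space UNIV"

definition sign_pm :: "real \<Rightarrow> real" where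
  "sign_pm x = (if x \<ge> 0 then 1 else -1)"

definition mvn_density :: "real^'d \<Rightarrow> real^'d^'d \<Rightarrow> real^'d \<Rightarrow> real" where
  "mvn_density \<mu> \<Sigma> x =
     exp (- ((x - \<mu>) \<bullet> (matrix_inv \<Sigma> *v (x - \<mu>))) / 2) / sqrt ((2 * pi) ^ CARD('d) * det \<Sigma>)"

text \<open>
  The model on an arbitrary probability space; \<^term>\<open>uniform_measure P {\<omega> \<in> space P. Y \<omega> = k}\<close> is
  the conditional probability given \<open>Y = k\<close>. Independence is stated for the generated
  \<open>\<sigma>\<close>-algebras because \<^const>\<open>prob_space.indep_var\<close> requires both variables to have the same type.
\<close>

definition lda_mcar ::
  "'w measure \<Rightarrow> ('w \<Rightarrow> real^'d) \<Rightarrow> ('w \<Rightarrow> bool^'d) \<Rightarrow> ('w \<Rightarrow> real) \<Rightarrow>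
   real^'d \<Rightarrow> real^'d \<Rightarrow> real^'d^'d \<Rightarrow> bool" where
  "lda_mcar P X M Y \<mu>\<^sub>1 \<mu>\<^sub>m\<^sub>1 \<Sigma> \<longleftrightarrow>
     prob_space P \<and>
     X \<in> measurable P borel \<and>
     M \<in> measurable P (count_space UNIV) \<and>
     Y \<in> measurable P (count_space {-1, 1}) \<and>
     measure P {\<omega> \<in> space P. Y \<omega> = 1} = measure P {\<omega> \<in> space P. Y \<omega> = -1} \<and>
     distributed (uniform_measure P {\<omega> \<in> space P. Y \<omega> = 1}) lborel X (\<lambda>x. ennreal (mvn_density \<mu>\<^sub>1 \<Sigma> x)) \<and>
     distributed (uniform_measure P {\<omega> \<in> space P. Y \<omega> = -1}) lborel X (\<lambda>x. ennreal (mvn_density \<mu>\<^sub>m\<^sub>1 \<Sigma> x)) \<and>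
     prob_space.indep_set P
       (sets (vimage_algebra (space P) M (count_space UNIV)))
       (sets (vimage_algebra (space P) (\<lambda>\<omega>. (X \<omega>, Y \<omega>)) (borel \<Otimes>\<^sub>M count_space {-1, 1})))"

definition misclassification_risk :: "'w measure \<Rightarrow> ('w \<Rightarrow> real) \<Rightarrow> ('w \<Rightarrow> real) \<Rightarrow> real" where
  "misclassification_risk P Y prediction = measure P {\<omega> \<in> space P. Y \<omega> \<noteq> prediction \<omega>}"

definition bayes_prediction ::
  "'w measure \<Rightarrow> ('w \<Rightarrow> real^'d::finite) \<Rightarrow> ('w \<Rightarrow> bool^'d) \<Rightarrow> ('w \<Rightarrow> real) \<Rightarrow> 'w \<Rightarrow> real" where
  "bayes_prediction P X M Y \<omega> =
     sign_pm (real_cond_exp P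
       (vimage_algebra (space P) (\<lambda>\<omega>. observe (X \<omega>) (M \<omega>)) observation_space) Y \<omega>)"

definition bayes_optimal ::
  "'w measure \<Rightarrow> ('w \<Rightarrow> real^'d::finite) \<Rightarrow> ('w \<Rightarrow> bool^'d) \<Rightarrow> ('w \<Rightarrow> real) \<Rightarrow>
   ('d observation \<Rightarrow> real) \<Rightarrow> bool" where
  "bayes_optimal P X M Y h \<longleftrightarrow>
     misclassification_risk P Y (\<lambda>\<omega>. h (observe (X \<omega>) (M \<omega>))) =
     misclassification_risk P Y (bayes_prediction P X M Y)"

definition imputed_classifier ::
  "real^'d \<Rightarrow> real \<Rightarrow> real^'d \<Rightarrow> ('d::finite) observation \<Rightarrow> real" where
  "imputed_classifier \<alpha> \<gamma>\<^sub>0 \<gamma> = (\<lambda>(x, m).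
     sign_pm (\<gamma>\<^sub>0 + (\<Sum>j\<in>UNIV. \<gamma> $ j * (x j * of_bool (\<not> m $ j) + \<alpha> $ j * of_bool (m $ j)))))"

text \<open>
  \<open>laws\<close> is the set of admissible distributions of \<open>M\<close>: \<^term>\<open>UNIV\<close> if the distribution of \<open>M\<close> is
  left unspecified, \<open>{\<nu>}\<close> if it is fixed. The constants \<open>\<alpha>, \<gamma>\<^sub>0, \<gamma>\<close> may depend on
  \<open>\<mu>\<^sub>1, \<mu>\<^sub>m\<^sub>1, \<Sigma>\<close> and on \<open>laws\<close>, but not on the individual triple \<open>(X, M, Y)\<close>.
  As all notions above depend only on the joint law of \<open>(X, M, Y)\<close>, it suffices to quantify over
  probability measures on triples, with the coordinate projections as \<open>X\<close>, \<open>M\<close> and \<open>Y\<close>.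
\<close>

definition optimal_imputation ::
  "(bool^'d) pmf set \<Rightarrow> real^'d \<Rightarrow> real^'d \<Rightarrow> real^'d^'d \<Rightarrow> real^'d::finite \<Rightarrow> bool" where
  "optimal_imputation laws \<mu>\<^sub>1 \<mu>\<^sub>m\<^sub>1 \<Sigma> \<alpha> \<longleftrightarrow>
     (\<exists>\<gamma>\<^sub>0 \<gamma>. \<forall>\<nu>\<in>laws. \<forall>P :: ((real^'d) \<times> (bool^'d) \<times> real) measure.
        let X = (\<lambda>(x, m, y). x); M = (\<lambda>(x, m, y). m); Y = (\<lambda>(x, m, y). y) in
          lda_mcar P X M Y \<mu>\<^sub>1 \<mu>\<^sub>m\<^sub>1 \<Sigma> \<and> distr P (count_space UNIV) M = measure_pmf \<nu> \<longrightarrow>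
          bayes_optimal P X M Y (imputed_classifier \<alpha> \<gamma>\<^sub>0 \<gamma>))"

definition constant_imputation_optimal ::
  "(bool^'d) pmf set \<Rightarrow> real^'d \<Rightarrow> real^'d \<Rightarrow> real^'d^'d::finite \<Rightarrow> bool" where
  "constant_imputation_optimal laws \<mu>\<^sub>1 \<mu>\<^sub>m\<^sub>1 \<Sigma> \<longleftrightarrow> (\<exists>\<alpha>. optimal_imputation laws \<mu>\<^sub>1 \<mu>\<^sub>m\<^sub>1 \<Sigma> \<alpha>)"

definition symmetric_positive_definite :: "real^'d^'d \<Rightarrow> bool" where
  "symmetric_positive_definite \<Sigma> \<longleftrightarrow> transpose \<Sigma> = \<Sigma> \<and> (\<forall>v. v \<noteq> 0 \<longrightarrow> v \<bullet> (\<Sigma> *v v) > 0)"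

definition diagonal_matrix :: "real^'d^'d \<Rightarrow> bool" where
  "diagonal_matrix \<Sigma> \<longleftrightarrow> (\<forall>i j. i \<noteq> j \<longrightarrow> \<Sigma> $ i $ j = 0)"

end

theory Submission
  imports Defs
begin

text \<open>
  Write \<open>\<delta> = \<mu>\<^sub>1 - \<mu>\<^sub>m\<^sub>1\<close>, and let \<open>a\<close> be the midpoint of the two means. Since the mask is independent of
  \<open>(X, Y)\<close>, the risk of a classifier is a weighted sum, over the masks \<open>m\<close>, of its risks in the problem of
  telling the two Gaussian classes apart from the coordinates in \<open>J = obs m\<close>. In each of these problems an
  optimal rule is the sign of \<open>w \<bullet> (x - a)\<close>, where \<open>w\<close> is supported in \<open>J\<close> and \<open>\<Sigma> *v w\<close> agrees with \<open>\<delta>\<close> on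
  \<open>J\<close> (\<open>class_gap_observed_halfspace\<close>). A classifier is Bayes optimal iff it does as well as any other
  classifier in the weighted sum (\<open>bayes_optimal_iff\<close>).

  If \<open>\<Sigma>\<close> is diagonal, the vectors \<open>w\<close> for different masks are restrictions of the single vector with entries
  \<open>\<delta>\<^sub>j / \<Sigma>\<^sub>j\<^sub>j\<close>, and imputing \<open>a\<^sub>j\<close> gives the missing coordinates the contribution zero
  (\<open>midpoint_imputation_optimal\<close>).

  Conversely, let \<open>\<Sigma>\<^sub>j\<^sub>i \<noteq> 0\<close> with \<open>i \<noteq> j\<close>, and take the means \<open>\<plusminus>\<Sigma> e\<^sub>i\<close>. For complete observations \<open>w\<close> is
  a multiple of \<open>e\<^sub>i\<close>, which forces the coefficient \<open>\<gamma>\<^sub>j\<close> of an optimal imputed classifier to be zero. This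
  classifier is therefore constant when only \<open>x\<^sub>j\<close> is observed, although \<open>x\<^sub>j\<close> has different means in the two
  classes (\<open>constant_imputation_optimal_imp_uncorrelated\<close>). Only the masks \<open>m = 0\<close> and \<open>obs m = {j}\<close> are
  used, and both have positive probability under every law of full support.

  Marginal distributions are avoided throughout: events that do not depend on the unobserved coordinates are
  insensitive to translations in these coordinates (\<open>gaussian_observed_marginal\<close>). The converse also needs
  the model to be realisable, hence the normalisation of the Gaussian density (\<open>nn_integral_mvn_density\<close>). It
  is obtained from a linear change of variables, which is proved here for arbitrary finite index types.
\<close>


section \<open>Linear change of variables\<close>

lemma nn_integral_lborel_translate:
  fixes f :: "'a::euclidean_space \<Rightarrow> ennreal"
  assumes [measurable]: "f \<in> borel_measurable borel"
  shows "(\<integral>\<^sup>+x. f (c + x) \<partial>lborel) = (\<integral>\<^sup>+x. f x \<partial>lborel)"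
proof -
  have "(\<integral>\<^sup>+x. f x \<partial>lborel) = (\<integral>\<^sup>+x. f x \<partial>distr lborel borel ((+) c))"
    by (simp only: lborel_distr_plus)
  then show ?thesis
    by (simp add: nn_integral_distr)
qed

text \<open>
  Tonelli's theorem and translation invariance let an integral be averaged first along the lines
  parallel to \<open>v\<close>. The weight depends only on the coordinate of \<open>x\<close> along \<open>v\<close> and has mass one on every
  such line. This replaces a decomposition of the space into a line and a complement.
\<close>
lemma nn_integral_lborel_average_along_line:
  fixes f :: "'a::euclidean_space \<Rightarrow> ennreal"
  assumes [measurable]: "f \<in> borel_measurable borel" and v: "v \<noteq> 0"
  shows "(\<integral>\<^sup>+x. f x \<partial>lborel) =
    (\<integral>\<^sup>+x. indicator {0..1} ((v \<bullet> x) / (v \<bullet> v)) * (\<integral>\<^sup>+s. f (x + s *\<^sub>R v) \<partial>lborel) \<partial>lborel)"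
proof -
  define \<phi> :: "real \<Rightarrow> ennreal" where "\<phi> = indicator {0..1}"
  define l where "l x = (v \<bullet> x) / (v \<bullet> v)" for x
  have [measurable]: "\<phi> \<in> borel_measurable borel" "l \<in> borel_measurable borel"
    unfolding \<phi>_def l_def by measurable
  have l: "l (x - s *\<^sub>R v) = l x - s" for s x
    using v by (simp add: l_def inner_diff_right diff_divide_distrib)
  have shift: "(\<integral>\<^sup>+s. \<phi> (l x - s) \<partial>lborel) = 1" for x
  proof -
    have "(\<integral>\<^sup>+s. \<phi> (l x - s) \<partial>lborel) = (\<integral>\<^sup>+s. \<phi> s \<partial>lborel)"
      using nn_integral_real_affine[of \<phi> "-1" "l x"] by simp
    then show ?thesis
      by (simp add: \<phi>_def)
  qed
  have "(\<integral>\<^sup>+x. \<phi> (l x) * (\<integral>\<^sup>+s. f (x + s *\<^sub>R v) \<partial>lborel) \<partial>lborel)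
      = (\<integral>\<^sup>+x. \<integral>\<^sup>+s. \<phi> (l x) * f (x + s *\<^sub>R v) \<partial>lborel \<partial>lborel)"
    by (simp add: nn_integral_cmult)
  also have "\<dots> = (\<integral>\<^sup>+s. \<integral>\<^sup>+x. \<phi> (l x) * f (x + s *\<^sub>R v) \<partial>lborel \<partial>lborel)"
    by (rule lborel_pair.Fubini') simp
  also have "\<dots> = (\<integral>\<^sup>+s. \<integral>\<^sup>+x. \<phi> (l x - s) * f x \<partial>lborel \<partial>lborel)"
  proof (rule nn_integral_cong)
    fix s
    show "(\<integral>\<^sup>+x. \<phi> (l x) * f (x + s *\<^sub>R v) \<partial>lborel) = (\<integral>\<^sup>+x. \<phi> (l x - s) * f x \<partial>lborel)"
      using nn_integral_lborel_translate[of "\<lambda>x. \<phi> (l x) * f (x + s *\<^sub>R v)" "- (s *\<^sub>R v)"]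
      by (simp add: l)
  qed
  also have "\<dots> = (\<integral>\<^sup>+x. \<integral>\<^sup>+s. \<phi> (l x - s) * f x \<partial>lborel \<partial>lborel)"
    by (rule lborel_pair.Fubini'[symmetric]) simp
  also have "\<dots> = (\<integral>\<^sup>+x. f x \<partial>lborel)"
    by (simp add: nn_integral_multc shift)
  finally show ?thesis
    by (simp add: \<phi>_def l_def)
qed

text \<open>
  The map \<open>x \<mapsto> x + (w \<bullet> x) v\<close> sends each line parallel to \<open>v\<close> to itself and scales it by \<open>1 + w \<bullet> v\<close>,
  the determinant of the map, so averaging along these lines reduces the claim to the affine change of
  variables on the real line.
\<close>
lemma nn_integral_lborel_rank_one_update:
  fixes f :: "'a::euclidean_space \<Rightarrow> ennreal"
  assumes [measurable]: "f \<in> borel_measurable borel" and c: "1 + w \<bullet> v \<noteq> 0"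
  shows "(\<integral>\<^sup>+x. f x \<partial>lborel) = ennreal \<bar>1 + w \<bullet> v\<bar> * (\<integral>\<^sup>+x. f (x + (w \<bullet> x) *\<^sub>R v) \<partial>lborel)"
proof (cases "v = 0")
  case False
  have line: "(\<integral>\<^sup>+s. f (x + s *\<^sub>R v) \<partial>lborel) =
      ennreal \<bar>1 + w \<bullet> v\<bar> * (\<integral>\<^sup>+s. f ((x + s *\<^sub>R v) + (w \<bullet> (x + s *\<^sub>R v)) *\<^sub>R v) \<partial>lborel)" for x
    using nn_integral_real_affine[OF _ c, of "\<lambda>s. f (x + s *\<^sub>R v)" "w \<bullet> x"]
    by (simp add: algebra_simps inner_add_right)
  show ?thesis
    unfolding nn_integral_lborel_average_along_line[OF assms(1) False]
      nn_integral_lborel_average_along_line[of "\<lambda>x. f (x + (w \<bullet> x) *\<^sub>R v)", OF _ False, simplified]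
    by (subst line) (simp add: nn_integral_cmult[symmetric] mult.left_commute)
qed simp

lemma axis_component: "axis k a $ i = (if i = k then a else 0)"
  by (simp add: axis_def)

text \<open>
  The linear change of variables formula for a dimension given by an arbitrary finite type, with no order
  on the indices. Substitutions compose and the determinant is multiplicative, so elementary matrices suffice;
  shears and transpositions are rank one updates of the identity.
\<close>
lemma nn_integral_lborel_matrix:
  fixes A :: "real^'n^'n" and f :: "real^'n \<Rightarrow> ennreal"
  assumes f: "f \<in> borel_measurable borel" and A: "det A \<noteq> 0"
  shows "(\<integral>\<^sup>+x. f x \<partial>lborel) = ennreal \<bar>det A\<bar> * (\<integral>\<^sup>+x. f (A *v x) \<partial>lborel)"
proof -
  define P where "P A \<longleftrightarrow> det A \<noteq> 0 \<longrightarrow> (\<forall>f \<in> borel_measurable borel.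
    (\<integral>\<^sup>+x. f x \<partial>lborel) = ennreal \<bar>det A\<bar> * (\<integral>\<^sup>+x. f (A *v x) \<partial>lborel))" for A :: "real^'n^'n"
  have [measurable]: "(*v) A \<in> borel_measurable borel" for A :: "real^'n^'n"
    by (intro borel_measurable_continuous_onI matrix_vector_mult_linear_continuous_on)
  have rank_one: "P A" if "\<And>x. A *v x = x + (w \<bullet> x) *\<^sub>R v" "det A = 1 + w \<bullet> v"
    for A :: "real^'n^'n" and v w
    unfolding P_def that by (intro impI ballI nn_integral_lborel_rank_one_update) simp_all
  have PD: "(\<integral>\<^sup>+x. f x \<partial>lborel) = ennreal \<bar>det A\<bar> * (\<integral>\<^sup>+x. f (A *v x) \<partial>lborel)"
    if "P A" "det A \<noteq> 0" "f \<in> borel_measurable borel" for A f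
    using that unfolding P_def by blast
  have "P A"
  proof (induction A rule: induct_matrix_elementary_alt)
    case (1 A B)
    show ?case
      unfolding P_def
    proof (intro impI ballI)
      fix f :: "real^'n \<Rightarrow> ennreal"
      assume "det (A ** B) \<noteq> 0" and [measurable]: "f \<in> borel_measurable borel"
      then have "det A \<noteq> 0" "det B \<noteq> 0"
        by (auto simp: det_mul)
      then have "(\<integral>\<^sup>+x. f x \<partial>lborel) = ennreal \<bar>det A\<bar> * (\<integral>\<^sup>+x. f (A *v x) \<partial>lborel)"
        and "(\<integral>\<^sup>+x. f (A *v x) \<partial>lborel) = ennreal \<bar>det B\<bar> * (\<integral>\<^sup>+x. f (A *v (B *v x)) \<partial>lborel)"
        using PD[OF 1(1), of f] PD[OF 1(2), of "\<lambda>x. f (A *v x)"] by simp_all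
      then show "(\<integral>\<^sup>+x. f x \<partial>lborel) = ennreal \<bar>det (A ** B)\<bar> * (\<integral>\<^sup>+x. f ((A ** B) *v x) \<partial>lborel)"
        by (simp add: det_mul abs_mult ennreal_mult mult.assoc matrix_vector_mul_assoc)
    qed
  next
    case (2 A i)
    then show ?case
      by (simp add: P_def det_zero_row)
  next
    case (3 A)
    define d where "d b = b \<bullet> (A *v b)" for b
    have B: "(Basis :: (real^'n) set) = range (\<lambda>i. axis i 1)"
      by (auto simp: Basis_vec_def)
    have inj: "inj (\<lambda>i. axis i 1 :: real^'n)"
      by (auto simp: inj_on_def axis_eq_axis)
    have c: "d (axis i 1) = A $ i $ i" for i
      by (simp add: d_def inner_axis' matrix_vector_mul_component inner_axis)
    have "(\<Sum>j\<in>UNIV. A $ i $ j * x $ j) = A $ i $ i * x $ i" for i and x :: "real^'n"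
      using 3 by (subst sum.remove[of _ i]) auto
    then have Ax: "(*v) A = (\<lambda>x. 0 + (\<Sum>b\<in>Basis. (d b * (x \<bullet> b)) *\<^sub>R b))"
      unfolding B sum.reindex[OF inj] o_def c
      by (simp add: fun_eq_iff vec_eq_iff matrix_vector_mult_def inner_axis)
        (simp add: axis_component if_distrib[of "(*) _"] cong: if_cong)
    have det: "\<bar>det A\<bar> = (\<Prod>b\<in>Basis. \<bar>d b\<bar>)"
      unfolding B prod.reindex[OF inj] o_def c using 3 by (simp add: det_diagonal abs_prod)
    show ?case
      unfolding P_def
    proof (intro impI ballI)
      fix f :: "real^'n \<Rightarrow> ennreal"
      assume "det A \<noteq> 0" and [measurable]: "f \<in> borel_measurable borel"
      then have "(\<Prod>b\<in>Basis. \<bar>d b\<bar>) \<noteq> 0"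
        by (simp flip: det)
      then have "d b \<noteq> 0" if "b \<in> Basis" for b
        using that by auto
      then have affine: "density (distr lborel borel ((*v) A)) (\<lambda>_. \<Prod>b\<in>Basis. \<bar>d b\<bar>) = lborel"
        using lborel_affine_euclidean[of d 0] unfolding Ax by simp
      have "(\<integral>\<^sup>+x. f x \<partial>lborel) =
          (\<integral>\<^sup>+x. f x \<partial>density (distr lborel borel ((*v) A)) (\<lambda>_. (\<Prod>b\<in>Basis. \<bar>d b\<bar>)))"
        by (simp only: affine)
      also have "\<dots> = ennreal \<bar>det A\<bar> * (\<integral>\<^sup>+x. f (A *v x) \<partial>lborel)"
        unfolding det[symmetric] by (simp add: nn_integral_density nn_integral_distr nn_integral_cmult)
      finally show "(\<integral>\<^sup>+x. f x \<partial>lborel) = ennreal \<bar>det A\<bar> * (\<integral>\<^sup>+x. f (A *v x) \<partial>lborel)" .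
    qed
  next
    case (4 m n)
    \<comment> \<open>A transposition of coordinates is the reflection in the hyperplane orthogonal to \<open>e\<^sub>m - e\<^sub>n\<close>.\<close>
    let ?\<tau> = "Transposition.transpose m n" and ?w = "axis m 1 - axis n 1 :: real^'n"
    let ?A = "(\<chi> i j. mat 1 $ i $ ?\<tau> j) :: real^'n^'n"
    have "(?A *v x) $ i = x $ ?\<tau> i" for x i
    proof -
      have "mat 1 $ i $ ?\<tau> j * x $ j = (if j = ?\<tau> i then x $ j else 0)" for j
        by (auto simp: mat_def)
      then show ?thesis
        by (simp add: matrix_vector_mult_def)
    qed
    moreover have "(x + (?w \<bullet> x) *\<^sub>R (- ?w)) $ i = x $ ?\<tau> i" for x i
      by (auto simp: Transposition.transpose_def inner_diff_left inner_axis' axis_component)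
    ultimately have "?A *v x = x + (?w \<bullet> x) *\<^sub>R (- ?w)" for x
      by (simp add: vec_eq_iff del: vector_add_component vector_scaleR_component)
    moreover have "det ?A = 1 + ?w \<bullet> (- ?w)"
      using 4 by (simp add: det_permute_columns permutes_swap_id sign_swap_id inner_diff_left inner_diff_right inner_axis axis_component)
    ultimately show ?case
      by (rule rank_one)
  next
    case (5 m n)
    let ?A = "(\<chi> i j. of_bool (i = m \<and> j = n \<or> i = j)) :: real^'n^'n"
    have "(?A *v x) $ i = (x + (axis n 1 \<bullet> x) *\<^sub>R axis m 1) $ i" for x i
    proof -
      have "of_bool (i = m \<and> j = n \<or> i = j) * x $ j =
          (if j = i then x $ j else 0) + (if j = n then of_bool (i = m) * x $ j else 0)" for j
        using 5 by auto
      then show ?thesis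
        by (simp only: matrix_vector_mult_def) (simp add: sum.distrib inner_axis' axis_component)
    qed
    then have "?A *v x = x + (axis n 1 \<bullet> x) *\<^sub>R axis m 1" for x
      by (simp add: vec_eq_iff)
    moreover have "det ?A = 1 + axis n 1 \<bullet> (axis m 1 :: real^'n)"
    proof -
      have "?A = (\<chi> k. if k = m then row m (mat 1) + 1 *s row n (mat 1) else row k (mat 1))"
        using 5 by (auto simp: vec_eq_iff row_def mat_def)
      then have "det ?A = det (mat 1 :: real^'n^'n)"
        using det_row_operation[OF 5, of "mat 1 :: real^'n^'n" 1] by (rule trans[OF arg_cong])
      then show ?thesis
        using 5 by (simp only: det_I) (simp add: inner_axis_axis)
    qed
    ultimately show ?case
      by (rule rank_one)
  qed
  then show ?thesis
    using A f by (rule PD)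
qed


section \<open>Gaussian densities with positive definite covariance\<close>

lemma symmetric_positive_definiteD:
  assumes "symmetric_positive_definite \<Sigma>"
  shows "x \<bullet> (\<Sigma> *v y) = y \<bullet> (\<Sigma> *v x)" and "v \<noteq> 0 \<Longrightarrow> v \<bullet> (\<Sigma> *v v) > 0"
proof -
  have "\<Sigma> *v x = x v* \<Sigma>"
    using assms by (metis symmetric_positive_definite_def transpose_matrix_vector)
  then show "x \<bullet> (\<Sigma> *v y) = y \<bullet> (\<Sigma> *v x)"
    by (simp add: dot_lmul_matrix[symmetric] inner_commute)
qed (use assms in \<open>auto simp: symmetric_positive_definite_def\<close>)

text \<open>
  Vectors that are orthonormal for the inner product \<open>v \<bullet> (\<Sigma> *v w)\<close> are chosen one at a time: fewer than
  \<open>n\<close> vectors \<open>\<Sigma> *v v\<close> do not span the space, so some nonzero vector is orthogonal to all of them, and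
  positive definiteness allows it to be normalised.
\<close>
lemma spd_orthonormal_vectors:
  fixes \<Sigma> :: "real^'n^'n"
  assumes spd: "symmetric_positive_definite \<Sigma>" and "k \<le> CARD('n)"
  shows "\<exists>V. finite V \<and> card V = k \<and> (\<forall>v\<in>V. \<forall>w\<in>V. v \<bullet> (\<Sigma> *v w) = of_bool (v = w))"
  using assms(2)
proof (induction k)
  case 0
  show ?case
    by (intro exI[of _ "{}"]) simp
next
  case (Suc k)
  then obtain V where V: "finite V" "card V = k"
    and orth: "\<And>v w. v \<in> V \<Longrightarrow> w \<in> V \<Longrightarrow> v \<bullet> (\<Sigma> *v w) = of_bool (v = w)"
    by auto
  have "dim ((*v) \<Sigma> ` V) \<le> card ((*v) \<Sigma> ` V)"
    using V by (intro dim_le_card') simp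
  also have "\<dots> \<le> k"
    using V card_image_le by blast
  finally have "dim ((*v) \<Sigma> ` V) < DIM(real^'n)"
    using Suc.prems by simp
  then obtain x where x: "x \<noteq> 0" "\<And>y. y \<in> span ((*v) \<Sigma> ` V) \<Longrightarrow> orthogonal x y"
    by (rule orthogonal_to_subspace_exists) (rule that)
  define y where "y = (1 / sqrt (x \<bullet> (\<Sigma> *v x))) *\<^sub>R x"
  have pos: "x \<bullet> (\<Sigma> *v x) > 0"
    using spd x(1) by (rule symmetric_positive_definiteD)
  then have "y \<bullet> (\<Sigma> *v y) = 1"
    by (simp add: y_def matrix_vector_mult_scaleR)
  moreover have yV: "y \<bullet> (\<Sigma> *v v) = 0" "v \<bullet> (\<Sigma> *v y) = 0" if "v \<in> V" for v
    using x(2)[of "\<Sigma> *v v"] that symmetric_positive_definiteD(1)[OF spd, of v y]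
    by (auto simp: y_def orthogonal_def span_base)
  ultimately have "y \<notin> V"
    by force
  with V orth yV \<open>y \<bullet> (\<Sigma> *v y) = 1\<close> show ?case
    by (intro exI[of _ "insert y V"]) auto
qed

lemma spd_congruent_to_identity:
  fixes \<Sigma> :: "real^'n^'n"
  assumes spd: "symmetric_positive_definite \<Sigma>"
  obtains B :: "real^'n^'n" where "transpose B ** (\<Sigma> ** B) = mat 1"
proof -
  obtain V where V: "finite V" "card V = CARD('n)"
    and orth: "\<And>v w. v \<in> V \<Longrightarrow> w \<in> V \<Longrightarrow> v \<bullet> (\<Sigma> *v w) = of_bool (v = w)"
    using spd_orthonormal_vectors[OF spd order_refl] by auto
  then obtain f :: "'n \<Rightarrow> real^'n" where f: "bij_betw f UNIV V"
    using finite_same_card_bij[of "UNIV :: 'n set" V] by auto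
  define B :: "real^'n^'n" where "B = (\<chi> i j. f j $ i)"
  have col: "B *v axis j 1 = f j" for j
    by (simp add: matrix_vector_mult_basis column_def B_def)
  have entry: "A $ i $ j = axis i 1 \<bullet> (A *v axis j 1)" for A :: "real^'n^'n" and i j
    by (simp add: inner_axis' matrix_vector_mult_basis column_def)
  have "(transpose B ** (\<Sigma> ** B)) $ i $ j = of_bool (i = j)" for i j
  proof -
    have "(transpose B ** (\<Sigma> ** B)) $ i $ j
        = axis i 1 \<bullet> (transpose B *v (\<Sigma> *v (B *v axis j 1)))"
      by (simp add: entry matrix_vector_mul_assoc[symmetric])
    also have "\<dots> = f i \<bullet> (\<Sigma> *v f j)"
      by (simp add: col dot_lmul_matrix[symmetric] flip: transpose_matrix_vector)
    also have "\<dots> = of_bool (i = j)"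
      using f orth[of "f i" "f j"] by (auto simp: bij_betw_def inj_def)
    finally show ?thesis .
  qed
  then show thesis
    by (intro that[of B]) (simp add: vec_eq_iff mat_def of_bool_def)
qed

lemma spd_invertible:
  fixes \<Sigma> :: "real^'n^'n"
  assumes spd: "symmetric_positive_definite \<Sigma>"
  shows spd_det_pos: "det \<Sigma> > 0"
    and spd_inverse: "matrix_inv \<Sigma> *v (\<Sigma> *v x) = x" "\<Sigma> *v (matrix_inv \<Sigma> *v x) = x"
proof -
  obtain B :: "real^'n^'n" where B: "transpose B ** (\<Sigma> ** B) = mat 1"
    using spd by (rule spd_congruent_to_identity)
  have "det B * det \<Sigma> * det B = 1"
    using arg_cong[OF B, of det] by (simp add: det_mul)
  then have "(det B)\<^sup>2 * det \<Sigma> = 1"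
    by (simp add: power2_eq_square algebra_simps)
  then show "det \<Sigma> > 0"
    by (metis zero_less_mult_pos zero_less_one zero_less_power2 mult_zero_left power_zero_numeral zero_neq_one)
  then have "det \<Sigma> \<noteq> 0"
    by simp
  then have "\<exists>A. \<Sigma> ** A = mat 1 \<and> A ** \<Sigma> = mat 1"
    by (simp add: invertible_det_nz flip: invertible_def)
  then have "\<Sigma> ** matrix_inv \<Sigma> = mat 1 \<and> matrix_inv \<Sigma> ** \<Sigma> = mat 1"
    unfolding matrix_inv_def by (rule someI_ex)
  then show "matrix_inv \<Sigma> *v (\<Sigma> *v x) = x" "\<Sigma> *v (matrix_inv \<Sigma> *v x) = x"
    by (simp_all add: matrix_vector_mul_assoc)
qed

text \<open>
  With \<open>B\<close> the matrix of an orthonormal basis for \<open>\<Sigma>\<close>, the matrix \<open>A = \<Sigma> B\<close> satisfies \<open>\<Sigma> = A A\<^sup>T\<close>; it carries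
  the standard Gaussian to the one with covariance \<open>\<Sigma>\<close>.
\<close>
lemma spd_square_root:
  fixes \<Sigma> :: "real^'n^'n"
  assumes spd: "symmetric_positive_definite \<Sigma>"
  obtains A :: "real^'n^'n" where "\<bar>det A\<bar> = sqrt (det \<Sigma>)"
    and "\<And>y. (A *v y) \<bullet> (matrix_inv \<Sigma> *v (A *v y)) = y \<bullet> y"
proof -
  obtain B :: "real^'n^'n" where B: "transpose B ** (\<Sigma> ** B) = mat 1"
    using spd by (rule spd_congruent_to_identity)
  define A where "A = \<Sigma> ** B"
  have "det B * det A = 1"
    using arg_cong[OF B, of det] by (simp add: det_mul A_def)
  moreover have "det A = det \<Sigma> * det B"
    by (simp add: A_def det_mul)
  ultimately have "(det A)\<^sup>2 = det \<Sigma>"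
    by (simp add: power2_eq_square)
  then have "\<bar>det A\<bar> = sqrt (det \<Sigma>)"
    by (metis real_sqrt_abs)
  moreover have "(A *v y) \<bullet> (matrix_inv \<Sigma> *v (A *v y)) = y \<bullet> y" for y
  proof -
    have "matrix_inv \<Sigma> *v (A *v y) = B *v y"
      using spd_inverse(1)[OF spd, of "B *v y"] by (simp add: A_def matrix_vector_mul_assoc)
    then have "(A *v y) \<bullet> (matrix_inv \<Sigma> *v (A *v y)) = y \<bullet> (transpose B *v (A *v y))"
      by (simp add: inner_commute dot_lmul_matrix[symmetric] transpose_matrix_vector)
    then show ?thesis
      using B by (simp add: A_def matrix_vector_mul_assoc)
  qed
  ultimately show thesis
    by (rule that)
qed

lemma borel_measurable_mvn_density [measurable]:
  "mvn_density \<mu> \<Sigma> \<in> borel_measurable borel"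
proof -
  have [measurable]: "(*v) (matrix_inv \<Sigma>) \<in> borel_measurable borel"
    by (intro borel_measurable_continuous_onI matrix_vector_mult_linear_continuous_on)
  show ?thesis
    unfolding mvn_density_def by measurable
qed

lemma mvn_density_pos:
  "symmetric_positive_definite \<Sigma> \<Longrightarrow> mvn_density \<mu> \<Sigma> x > 0"
  by (simp add: mvn_density_def spd_det_pos)

lemma mvn_density_shift: "mvn_density \<mu>' \<Sigma> x = mvn_density \<mu> \<Sigma> ((\<mu> - \<mu>') + x)"
  by (simp add: mvn_density_def algebra_simps)

text \<open>
  Without the normalisation of the density no triple \<open>(X, M, Y)\<close> would be known to satisfy the model, and
  optimality for all such triples could hold vacuously. After the substitution \<open>x = \<mu> + A y\<close> the density
  becomes a product of standard normal densities.
\<close>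
lemma nn_integral_mvn_density:
  fixes \<Sigma> :: "real^'n^'n"
  assumes spd: "symmetric_positive_definite \<Sigma>"
  shows "(\<integral>\<^sup>+x. mvn_density \<mu> \<Sigma> x \<partial>lborel) = 1"
proof -
  obtain A :: "real^'n^'n" where A: "\<bar>det A\<bar> = sqrt (det \<Sigma>)"
    "\<And>y. (A *v y) \<bullet> (matrix_inv \<Sigma> *v (A *v y)) = y \<bullet> y"
    using spd by (rule spd_square_root) (rule that)
  have d: "det \<Sigma> > 0"
    using spd by (rule spd_det_pos)
  have std: "\<bar>det A\<bar> * mvn_density 0 \<Sigma> (A *v y) = (\<Prod>b\<in>Basis. std_normal_density (y \<bullet> b))" for y
  proof -
    have "\<bar>det A\<bar> * mvn_density 0 \<Sigma> (A *v y) = exp (- (y \<bullet> y) / 2) / sqrt (2 * pi) ^ CARD('n)"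
      using d by (simp add: mvn_density_def A real_sqrt_mult real_sqrt_power power_mult_distrib)
    also have "- (y \<bullet> y) / 2 = (\<Sum>b\<in>Basis. - (y \<bullet> b)\<^sup>2 / 2)"
      by (subst euclidean_inner) (simp add: power2_eq_square sum_negf sum_divide_distrib)
    also have "exp \<dots> / sqrt (2 * pi) ^ CARD('n) = (\<Prod>b\<in>Basis. std_normal_density (y \<bullet> b))"
      by (simp add: exp_sum std_normal_density_def prod_dividef prod.distrib field_simps)
    finally show ?thesis .
  qed
  have "(\<integral>\<^sup>+x. mvn_density \<mu> \<Sigma> x \<partial>lborel) = (\<integral>\<^sup>+x. mvn_density 0 \<Sigma> (- \<mu> + x) \<partial>lborel)"
    by (subst mvn_density_shift[of \<mu> \<Sigma> _ 0]) simp
  also have "\<dots> = (\<integral>\<^sup>+x. mvn_density 0 \<Sigma> x \<partial>lborel)"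
    by (rule nn_integral_lborel_translate) simp
  also have "\<dots> = ennreal \<bar>det A\<bar> * (\<integral>\<^sup>+y. mvn_density 0 \<Sigma> (A *v y) \<partial>lborel)"
    using A d by (intro nn_integral_lborel_matrix) auto
  also have "\<dots> = (\<integral>\<^sup>+y. ennreal (\<bar>det A\<bar> * mvn_density 0 \<Sigma> (A *v y)) \<partial>lborel)"
  proof -
    have [measurable]: "(*v) A \<in> borel_measurable borel"
      by (intro borel_measurable_continuous_onI matrix_vector_mult_linear_continuous_on)
    show ?thesis
      by (subst nn_integral_cmult[symmetric]) (auto simp: ennreal_mult')
  qed
  also have "\<dots> = (\<integral>\<^sup>+y. (\<Prod>b\<in>Basis. ennreal (std_normal_density (y \<bullet> b))) \<partial>(lborel :: (real^'n) measure))"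
    by (simp add: std prod_ennreal)
  also have "\<dots> = (\<Prod>b\<in>(Basis :: (real^'n) set). \<integral>\<^sup>+t. std_normal_density t \<partial>lborel)"
    by (intro nn_integral_lborel_prod) auto
  also have "(\<integral>\<^sup>+t. std_normal_density t \<partial>lborel) = 1"
    using prob_space.emeasure_space_1[OF prob_space_normal_density[of 1 0]]
    by (simp add: emeasure_density)
  finally show ?thesis
    by simp
qed

definition gaussian :: "real^'n^'n \<Rightarrow> real^'n \<Rightarrow> (real^'n) measure" where
  "gaussian \<Sigma> \<mu> = density lborel (\<lambda>x. ennreal (mvn_density \<mu> \<Sigma> x))"

lemma sets_gaussian [measurable_cong, simp]: "sets (gaussian \<Sigma> \<mu>) = sets borel"
  and space_gaussian [simp]: "space (gaussian \<Sigma> \<mu>) = UNIV"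
  by (simp_all add: gaussian_def)

lemma prob_space_gaussian:
  "symmetric_positive_definite \<Sigma> \<Longrightarrow> prob_space (gaussian \<Sigma> \<mu>)"
  by (rule prob_spaceI) (simp add: gaussian_def emeasure_density nn_integral_mvn_density)


section \<open>Optimal classification of two Gaussian classes\<close>

text \<open>
  For a common covariance the quadratic terms of the two exponents cancel, so the log-likelihood ratio is
  affine, vanishes at the midpoint of the means and has slope \<open>w = \<Sigma>\<^sup>-\<^sup>1 (\<mu> - \<mu>')\<close>.
\<close>
lemma mvn_density_tilt:
  assumes spd: "symmetric_positive_definite \<Sigma>" and w: "\<mu> - \<mu>' = \<Sigma> *v w"
  shows "mvn_density \<mu> \<Sigma> x = exp (w \<bullet> (x - (1/2) *\<^sub>R (\<mu> + \<mu>'))) * mvn_density \<mu>' \<Sigma> x"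
proof -
  define u where "u = x - \<mu>"
  let ?S = "matrix_inv \<Sigma>"
  have x: "x - \<mu>' = u + \<Sigma> *v w"
    by (simp add: u_def flip: w)
  have cross: "(\<Sigma> *v w) \<bullet> (?S *v u) = w \<bullet> u"
    by (metis spd symmetric_positive_definiteD(1) inner_commute spd_inverse(2))
  have "(x - \<mu>') \<bullet> (?S *v (x - \<mu>')) = u \<bullet> (?S *v u) + 2 * (w \<bullet> u) + w \<bullet> (\<Sigma> *v w)"
    by (simp add: x matrix_vector_right_distrib inner_add_left inner_add_right spd_inverse[OF spd]
        cross inner_commute[of u w] inner_commute[of "\<Sigma> *v w" w])
  moreover have "2 * (w \<bullet> (x - (1/2) *\<^sub>R (\<mu> + \<mu>'))) = 2 * (w \<bullet> u) + w \<bullet> (\<Sigma> *v w)"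
    by (simp add: u_def inner_diff_right inner_add_right algebra_simps flip: w)
  ultimately have "- (u \<bullet> (?S *v u)) / 2
      = w \<bullet> (x - (1/2) *\<^sub>R (\<mu> + \<mu>')) + - ((x - \<mu>') \<bullet> (?S *v (x - \<mu>'))) / 2"
    by linarith
  then show ?thesis
    unfolding mvn_density_def u_def by (simp only: exp_add times_divide_eq_right)
qed

lemma measure_gaussian:
  assumes spd: "symmetric_positive_definite \<Sigma>" and [measurable]: "A \<in> sets borel"
  shows "integrable lborel (\<lambda>x. indicator A x * mvn_density \<mu> \<Sigma> x)"
    and "measure (gaussian \<Sigma> \<mu>) A = (\<integral>x. indicator A x * mvn_density \<mu> \<Sigma> x \<partial>lborel)"
proof -
  have nn: "0 \<le> mvn_density \<mu> \<Sigma> x" for x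
    using mvn_density_pos[OF spd] by (rule less_imp_le)
  have int: "integrable lborel (mvn_density \<mu> \<Sigma>)"
    using nn by (intro integrableI_nonneg) (auto simp: nn_integral_mvn_density[OF spd])
  show "integrable lborel (\<lambda>x. indicator A x * mvn_density \<mu> \<Sigma> x)"
    by (rule Bochner_Integration.integrable_bound[OF int]) (auto simp: indicator_def)
  have "emeasure (gaussian \<Sigma> \<mu>) A = (\<integral>\<^sup>+x. ennreal (indicator A x * mvn_density \<mu> \<Sigma> x) \<partial>lborel)"
    by (auto simp: gaussian_def emeasure_density indicator_def intro!: nn_integral_cong)
  then show "measure (gaussian \<Sigma> \<mu>) A = (\<integral>x. indicator A x * mvn_density \<mu> \<Sigma> x \<partial>lborel)"
    using nn by (subst integral_eq_nn_integral) (auto simp: measure_def)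
qed

text \<open>
  If a classifier predicts \<open>1\<close> exactly on \<open>A\<close> and the classes \<open>1\<close> and \<open>-1\<close> have means \<open>\<mu>\<close> and \<open>\<mu>'\<close> and equal
  weights, then its error probability is \<open>(1 - class_gap \<Sigma> \<mu> \<mu>' A) / 2\<close>.
\<close>
definition class_gap :: "real^'n^'n \<Rightarrow> real^'n \<Rightarrow> real^'n \<Rightarrow> (real^'n) set \<Rightarrow> real" where
  "class_gap \<Sigma> \<mu> \<mu>' A = measure (gaussian \<Sigma> \<mu>) A - measure (gaussian \<Sigma> \<mu>') A"

text \<open>
  This is the Neyman-Pearson argument: the set where the first density is at least the second maximises the
  difference of the probabilities, and by \<open>mvn_density_tilt\<close> it is a half-space. A maximiser can differ from
  it only on a null set, and off the bounding hyperplane no nonempty open set is null.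
\<close>
lemma class_gap_halfspace:
  fixes \<mu> \<mu>' w :: "real^'n"
  defines "l x \<equiv> w \<bullet> (x - (1/2) *\<^sub>R (\<mu> + \<mu>'))"
  assumes spd: "symmetric_positive_definite \<Sigma>" and w: "\<mu> - \<mu>' = \<Sigma> *v w"
    and [measurable]: "A \<in> sets borel"
  shows "class_gap \<Sigma> \<mu> \<mu>' A \<le> class_gap \<Sigma> \<mu> \<mu>' {x. 0 \<le> l x}"
    and "class_gap \<Sigma> \<mu> \<mu>' A = class_gap \<Sigma> \<mu> \<mu>' {x. 0 \<le> l x} \<Longrightarrow> open U \<Longrightarrow>
      (\<And>x. x \<in> U \<Longrightarrow> if x \<in> A then l x < 0 else l x > 0) \<Longrightarrow> U = {}"
proof -
  let ?f = "mvn_density \<mu> \<Sigma>" and ?g = "mvn_density \<mu>' \<Sigma>"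
  let ?B = "{x. 0 \<le> l x}"
  define D where "D x = (indicator ?B x - indicator A x) * (?f x - ?g x)" for x
  have [measurable]: "l \<in> borel_measurable borel"
    unfolding l_def by measurable
  have B [measurable]: "?B \<in> sets borel"
    by measurable
  note int = measure_gaussian[OF spd \<open>A \<in> sets borel\<close>] measure_gaussian[OF spd B]
  have D_eq: "D = (\<lambda>x. indicator ?B x * ?f x - indicator ?B x * ?g x
      - (indicator A x * ?f x - indicator A x * ?g x))"
    by (simp add: D_def fun_eq_iff algebra_simps)
  have int_D: "integrable lborel D"
    unfolding D_eq by (intro Bochner_Integration.integrable_diff int)
  have gap: "class_gap \<Sigma> \<mu> \<mu>' ?B - class_gap \<Sigma> \<mu> \<mu>' A = (\<integral>x. D x \<partial>lborel)"
    by (simp add: class_gap_def int D_eq)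
  \<comment> \<open>\<open>f - g\<close> has the sign of \<open>l\<close>, and \<open>D\<close> weights it by a factor that never has the opposite sign.\<close>
  have fg: "?f x - ?g x = (exp (l x) - 1) * ?g x" for x
    by (simp add: mvn_density_tilt[OF spd w] l_def algebra_simps)
  have g: "?g x > 0" for x
    using spd by (rule mvn_density_pos)
  have D_nonneg: "0 \<le> D x" for x
    using g[of x] unfolding D_def fg
    by (auto simp: indicator_def zero_le_mult_iff mult_le_0_iff not_le less_imp_le)
  then have "0 \<le> (\<integral>x. D x \<partial>lborel)"
    by (rule Bochner_Integration.integral_nonneg)
  with gap show "class_gap \<Sigma> \<mu> \<mu>' A \<le> class_gap \<Sigma> \<mu> \<mu>' ?B"
    by simp
  assume "class_gap \<Sigma> \<mu> \<mu>' A = class_gap \<Sigma> \<mu> \<mu>' ?B"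
    and U: "open U" "\<And>x. x \<in> U \<Longrightarrow> if x \<in> A then l x < 0 else l x > 0"
  then have "(\<integral>x. D x \<partial>lborel) = 0"
    using gap by simp
  then have "AE x in lborel. D x = 0"
    using integral_nonneg_eq_0_iff_AE[OF int_D] D_nonneg by simp
  moreover have "D x \<noteq> 0" if "x \<in> U" for x
    using U(2)[OF that] g[of x] unfolding D_def fg by (auto simp: indicator_def split: if_splits)
  ultimately have "AE x in lborel. x \<notin> U"
    by (auto elim: eventually_mono)
  moreover have "U \<in> sets lborel"
    using U(1) by simp
  ultimately have "U \<in> null_sets lborel"
    by (subst (asm) AE_iff_null_sets[symmetric]) auto
  then have "negligible U"
    by (simp add: negligible_iff_null_sets null_sets_completionI)
  then show "U = {}"
    using open_not_negligible[OF U(1)] by blast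
qed

text \<open>
  If the event does not look at the coordinates outside \<open>J\<close>, then translating the mean in these coordinates
  changes nothing. This takes the place of computing marginal distributions.
\<close>
lemma gaussian_observed_marginal:
  assumes A [measurable]: "A \<in> sets borel"
    and dep: "\<And>x y. (\<And>j. j \<in> J \<Longrightarrow> x $ j = y $ j) \<Longrightarrow> x \<in> A \<longleftrightarrow> y \<in> A"
    and \<mu>: "\<And>j. j \<in> J \<Longrightarrow> \<mu> $ j = \<mu>' $ j"
  shows "measure (gaussian \<Sigma> \<mu>) A = measure (gaussian \<Sigma> \<mu>') A"
proof -
  have ind: "indicator A ((\<mu> - \<mu>') + x) = (indicator A x :: ennreal)" for x
    using dep[of "(\<mu> - \<mu>') + x" x] \<mu> by (auto simp: indicator_def)
  have "emeasure (gaussian \<Sigma> \<mu>) A = (\<integral>\<^sup>+x. ennreal (mvn_density \<mu> \<Sigma> x) * indicator A x \<partial>lborel)"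
    by (simp add: gaussian_def emeasure_density)
  also have "\<dots> = (\<integral>\<^sup>+x. ennreal (mvn_density \<mu> \<Sigma> ((\<mu> - \<mu>') + x)) * indicator A ((\<mu> - \<mu>') + x) \<partial>lborel)"
    by (rule nn_integral_lborel_translate[symmetric]) simp
  also have "\<dots> = emeasure (gaussian \<Sigma> \<mu>') A"
    unfolding ind mvn_density_shift[symmetric] by (simp add: gaussian_def emeasure_density)
  finally show ?thesis
    by (simp add: measure_def)
qed

text \<open>
  The optimal rule given only the coordinates in \<open>J\<close>. The mean \<open>\<mu>'\<close> may be altered off \<open>J\<close> so that the difference
  of the means becomes \<open>\<Sigma> *v w\<close>. As \<open>w\<close> is supported in \<open>J\<close>, the half-space that is optimal for full observations
  depends only on the coordinates in \<open>J\<close>, so it is also optimal among the events observable on \<open>J\<close>. Here \<open>w\<close>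
  restricted to \<open>J\<close> is \<open>\<Sigma>\<^sub>J\<^sub>J\<^sup>-\<^sup>1 (\<mu> - \<mu>')\<^sub>J\<close>.
\<close>
lemma class_gap_observed_halfspace:
  fixes \<mu> \<mu>' w :: "real^'n"
  defines "l x \<equiv> \<Sum>j\<in>UNIV. w $ j * (x $ j - (\<mu> $ j + \<mu>' $ j) / 2)"
  assumes spd: "symmetric_positive_definite \<Sigma>"
    and supp: "\<And>j. j \<notin> J \<Longrightarrow> w $ j = 0"
    and w: "\<And>j. j \<in> J \<Longrightarrow> (\<Sigma> *v w) $ j = \<mu> $ j - \<mu>' $ j"
    and A [measurable]: "A \<in> sets borel"
    and dep: "\<And>x y. (\<And>j. j \<in> J \<Longrightarrow> x $ j = y $ j) \<Longrightarrow> x \<in> A \<longleftrightarrow> y \<in> A"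
  shows "class_gap \<Sigma> \<mu> \<mu>' A \<le> class_gap \<Sigma> \<mu> \<mu>' {x. 0 \<le> l x}"
    and "class_gap \<Sigma> \<mu> \<mu>' A = class_gap \<Sigma> \<mu> \<mu>' {x. 0 \<le> l x} \<Longrightarrow> open U \<Longrightarrow>
      (\<And>x. x \<in> U \<Longrightarrow> if x \<in> A then l x < 0 else l x > 0) \<Longrightarrow> U = {}"
proof -
  define \<nu> where "\<nu> = \<mu> - \<Sigma> *v w"
  have \<nu>: "\<nu> $ j = \<mu>' $ j" if "j \<in> J" for j
    using w[OF that] by (simp add: \<nu>_def)
  have l: "l x = w \<bullet> (x - (1/2) *\<^sub>R (\<mu> + \<nu>))" for x
    unfolding l_def inner_vec_def
  proof (rule sum.cong)
    fix j
    show "w $ j * (x $ j - (\<mu> $ j + \<mu>' $ j) / 2) = w $ j \<bullet> (x - (1/2) *\<^sub>R (\<mu> + \<nu>)) $ j"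
      using supp[of j] \<nu>[of j] by (cases "j \<in> J") auto
  qed simp
  have [measurable]: "l \<in> borel_measurable borel"
    unfolding l by measurable
  have dep_l: "l x = l y" if "\<And>j. j \<in> J \<Longrightarrow> x $ j = y $ j" for x y
    unfolding l_def
  proof (rule sum.cong)
    fix j
    show "w $ j * (x $ j - (\<mu> $ j + \<mu>' $ j) / 2) = w $ j * (y $ j - (\<mu> $ j + \<mu>' $ j) / 2)"
      using supp[of j] that[of j] by (cases "j \<in> J") auto
  qed simp
  have "measure (gaussian \<Sigma> \<nu>) A = measure (gaussian \<Sigma> \<mu>') A"
    using A dep \<nu> by (rule gaussian_observed_marginal)
  then have gA: "class_gap \<Sigma> \<mu> \<mu>' A = class_gap \<Sigma> \<mu> \<nu> A"
    by (simp add: class_gap_def)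
  have "measure (gaussian \<Sigma> \<nu>) {x. 0 \<le> l x} = measure (gaussian \<Sigma> \<mu>') {x. 0 \<le> l x}"
  proof (rule gaussian_observed_marginal[where J = J])
    fix x y :: "real^'n"
    assume "\<And>j. j \<in> J \<Longrightarrow> x $ j = y $ j"
    then show "x \<in> {x. 0 \<le> l x} \<longleftrightarrow> y \<in> {x. 0 \<le> l x}"
      using dep_l[of x y] by simp
  qed (use \<nu> in auto)
  then have gB: "class_gap \<Sigma> \<mu> \<mu>' {x. 0 \<le> l x} = class_gap \<Sigma> \<mu> \<nu> {x. 0 \<le> l x}"
    by (simp add: class_gap_def)
  have w': "\<mu> - \<nu> = \<Sigma> *v w"
    by (simp add: \<nu>_def)
  show "class_gap \<Sigma> \<mu> \<mu>' A \<le> class_gap \<Sigma> \<mu> \<mu>' {x. 0 \<le> l x}"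
    unfolding gA gB unfolding l by (rule class_gap_halfspace[OF spd w' A])
  show "class_gap \<Sigma> \<mu> \<mu>' A = class_gap \<Sigma> \<mu> \<mu>' {x. 0 \<le> l x} \<Longrightarrow> open U \<Longrightarrow>
      (\<And>x. x \<in> U \<Longrightarrow> if x \<in> A then l x < 0 else l x > 0) \<Longrightarrow> U = {}"
    unfolding gA gB unfolding l by (rule class_gap_halfspace[OF spd w' A])
qed


section \<open>Bayes classifiers and the misclassification risk\<close>

definition classifier :: "('d::finite observation \<Rightarrow> real) \<Rightarrow> bool" where
  "classifier h \<longleftrightarrow> h \<in> borel_measurable observation_space \<and> range h \<subseteq> {-1, 1}"

lemma classifier_measurable: "classifier h \<Longrightarrow> h \<in> borel_measurable observation_space"
  and classifier_cases: "classifier h \<Longrightarrow> h z = 1 \<or> h z = -1"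
  by (auto simp: classifier_def)

lemma measurable_label:
  "Y \<in> measurable P (count_space {-1, 1 :: real}) \<Longrightarrow> Y \<in> borel_measurable P"
  by (rule measurable_compose[where g = "\<lambda>y. y"]) auto

lemma measurable_observe:
  fixes X :: "'w \<Rightarrow> real^'d::finite"
  assumes [measurable]: "X \<in> measurable P borel" and M: "M \<in> measurable P (count_space UNIV)"
  shows "(\<lambda>\<omega>. observe (X \<omega>) (M \<omega>)) \<in> measurable P observation_space"
proof -
  have "(\<lambda>\<omega> j. if \<not> M \<omega> $ j then X \<omega> $ j else undefined) \<in> measurable P (\<Pi>\<^sub>M j\<in>UNIV. borel)"
  proof (rule measurable_PiM_single')
    fix j
    have "(\<lambda>\<omega>. M \<omega> $ j) \<in> measurable P (count_space UNIV)"
      using M by (rule measurable_compose) simp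
    moreover have "(\<lambda>x. x $ j) \<in> borel_measurable (borel :: (real^'d) measure)"
      by (intro borel_measurable_continuous_onI continuous_intros)
    ultimately show "(\<lambda>\<omega>. if \<not> M \<omega> $ j then X \<omega> $ j else undefined) \<in> borel_measurable P"
      by measurable
  qed auto
  moreover have "restrict (($) (X \<omega>)) (obs (M \<omega>)) = (\<lambda>j. if \<not> M \<omega> $ j then X \<omega> $ j else undefined)" for \<omega>
    by (auto simp: obs_def)
  ultimately show ?thesis
    unfolding observe_def observation_space_def by (intro measurable_Pair M) simp
qed

lemma classifier_region:
  assumes "classifier h"
  shows "{x. h (observe x m) = 1} \<in> sets borel"
proof -
  have "(\<lambda>x. observe x m) \<in> measurable borel observation_space"
    by (rule measurable_observe) auto
  then have "(\<lambda>x. h (observe x m)) \<in> borel_measurable borel"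
    using classifier_measurable[OF assms] by (rule measurable_compose)
  then have "(\<lambda>x. h (observe x m)) -` {1} \<inter> space borel \<in> sets borel"
    by (rule measurable_sets) simp
  then show ?thesis
    by (simp add: vimage_def)
qed

lemma misclassification_risk_correlation:
  assumes "prob_space P" and Y: "Y \<in> measurable P (count_space {-1, 1})"
    and k [measurable]: "k \<in> borel_measurable P" and k_pm: "\<And>\<omega>. k \<omega> = 1 \<or> k \<omega> = -1"
  shows "misclassification_risk P Y k = (1 - (\<integral>\<omega>. k \<omega> * Y \<omega> \<partial>P)) / 2"
proof -
  interpret prob_space P by fact
  have [measurable]: "Y \<in> borel_measurable P"
    using Y by (rule measurable_label)
  let ?E = "{\<omega> \<in> space P. Y \<omega> \<noteq> k \<omega>}"
  have E [measurable]: "?E \<in> sets P"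
    by measurable
  have "(\<integral>\<omega>. k \<omega> * Y \<omega> \<partial>P) = (\<integral>\<omega>. 1 - 2 * indicator ?E \<omega> \<partial>P)"
  proof (rule Bochner_Integration.integral_cong)
    fix \<omega> assume "\<omega> \<in> space P"
    then have "Y \<omega> = 1 \<or> Y \<omega> = -1"
      using measurable_space[OF Y] by auto
    then show "k \<omega> * Y \<omega> = 1 - 2 * indicator ?E \<omega>"
      using k_pm[of \<omega>] \<open>\<omega> \<in> space P\<close> by auto
  qed simp
  also have "\<dots> = 1 - 2 * prob ?E"
    using E by (subst Bochner_Integration.integral_diff) (auto simp: prob_space emeasure_eq_measure)
  finally show ?thesis
    by (simp add: misclassification_risk_def)
qed

text \<open>
  For predictions \<open>k\<close> with values \<open>\<plusminus>1\<close> the risk is \<open>(1 - E[k Y]) / 2\<close>. If \<open>k\<close> is a function of \<open>Z\<close>, then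
  \<open>E[k Y] = E[k E[Y|Z]]\<close>, which is largest for the sign of \<open>E[Y|Z]\<close>. This prediction is measurable for the
  \<open>\<sigma>\<close>-algebra generated by \<open>Z\<close>, hence is itself a classifier applied to \<open>Z\<close>.
\<close>
lemma bayes_prediction_optimal:
  assumes "prob_space P"
    and X: "X \<in> measurable P borel" and M: "M \<in> measurable P (count_space UNIV)"
    and Y: "Y \<in> measurable P (count_space {-1, 1})"
  shows bayes_prediction_le: "classifier h \<Longrightarrow> misclassification_risk P Y (bayes_prediction P X M Y)
      \<le> misclassification_risk P Y (\<lambda>\<omega>. h (observe (X \<omega>) (M \<omega>)))"
    and bayes_prediction_attained: "\<exists>h. classifier h \<and>
      misclassification_risk P Y (\<lambda>\<omega>. h (observe (X \<omega>) (M \<omega>)))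
      = misclassification_risk P Y (bayes_prediction P X M Y)"
proof -
  interpret prob_space P by fact
  define Z where "Z \<omega> = observe (X \<omega>) (M \<omega>)" for \<omega>
  define F where "F = vimage_algebra (space P) Z observation_space"
  define \<eta> where "\<eta> = real_cond_exp P F Y"
  have Y_meas [measurable]: "Y \<in> borel_measurable P"
    using Y by (rule measurable_label)
  have Z: "Z \<in> measurable P observation_space"
    unfolding Z_def using X M by (rule measurable_observe)
  have sub: "subalgebra P F"
    using measurable_sets[OF Z] measurable_space[OF Z] unfolding subalgebra_def F_def
    by (auto simp: sets_vimage_algebra2)
  interpret F: finite_measure_subalgebra P F
    using sub by unfold_locales
  have ZF: "Z \<in> measurable F observation_space"
    unfolding F_def using measurable_space[OF Z] by (intro measurable_vimage_algebra1) auto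
  have \<eta>F [measurable]: "\<eta> \<in> borel_measurable F" and [measurable]: "\<eta> \<in> borel_measurable P"
    unfolding \<eta>_def by auto
  have "\<bar>Y \<omega>\<bar> \<le> 1" if "\<omega> \<in> space P" for \<omega>
    using measurable_space[OF Y that] by auto
  then have int_Y: "integrable P Y"
    by (intro integrable_const_bound[of _ 1] AE_I2) auto
  have int_\<eta>: "integrable P \<eta>"
    unfolding \<eta>_def using int_Y by (rule F.real_cond_exp_int)
  have sign_F: "(\<lambda>\<omega>. sign_pm (\<eta> \<omega>)) \<in> borel_measurable F"
    unfolding sign_pm_def by measurable
  have bayes: "bayes_prediction P X M Y = (\<lambda>\<omega>. sign_pm (\<eta> \<omega>))"
    by (simp add: fun_eq_iff bayes_prediction_def \<eta>_def F_def Z_def[abs_def])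
  have corr: "(\<integral>\<omega>. k \<omega> * Y \<omega> \<partial>P) = (\<integral>\<omega>. k \<omega> * \<eta> \<omega> \<partial>P)"
    if k: "k \<in> borel_measurable F" and "\<And>\<omega>. k \<omega> = 1 \<or> k \<omega> = -1" for k
  proof -
    have [measurable]: "k \<in> borel_measurable P"
      using k sub by (rule measurable_from_subalg[rotated])
    have "\<bar>k \<omega>\<bar> = 1" for \<omega>
      using that(2)[of \<omega>] by auto
    then have "integrable P (\<lambda>\<omega>. k \<omega> * Y \<omega>)"
      using int_Y by (elim Bochner_Integration.integrable_bound) (auto simp: abs_mult)
    then show ?thesis
      unfolding \<eta>_def using k Y_meas by (rule F.real_cond_exp_intg(2)[symmetric])
  qed
  show "misclassification_risk P Y (bayes_prediction P X M Y)
      \<le> misclassification_risk P Y (\<lambda>\<omega>. h (observe (X \<omega>) (M \<omega>)))" if h: "classifier h"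
  proof -
    have hF: "(\<lambda>\<omega>. h (Z \<omega>)) \<in> borel_measurable F"
      using ZF classifier_measurable[OF h] by (rule measurable_compose)
    have [measurable]: "(\<lambda>\<omega>. h (Z \<omega>)) \<in> borel_measurable P" "(\<lambda>\<omega>. sign_pm (\<eta> \<omega>)) \<in> borel_measurable P"
      using measurable_from_subalg[OF sub] hF sign_F by auto
    have pm: "h z = 1 \<or> h z = -1" for z
      using h by (rule classifier_cases)
    have abs: "\<bar>h z\<bar> = 1" for z
      using pm[of z] by auto
    have "(\<integral>\<omega>. h (Z \<omega>) * \<eta> \<omega> \<partial>P) \<le> (\<integral>\<omega>. sign_pm (\<eta> \<omega>) * \<eta> \<omega> \<partial>P)"
    proof (rule integral_mono)
      show "integrable P (\<lambda>\<omega>. h (Z \<omega>) * \<eta> \<omega>)" "integrable P (\<lambda>\<omega>. sign_pm (\<eta> \<omega>) * \<eta> \<omega>)"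
        using int_\<eta> by (auto elim!: Bochner_Integration.integrable_bound simp: abs_mult abs sign_pm_def)
    next
      fix \<omega>
      show "h (Z \<omega>) * \<eta> \<omega> \<le> sign_pm (\<eta> \<omega>) * \<eta> \<omega>"
        using pm[of "Z \<omega>"] by (auto simp: sign_pm_def)
    qed
    then have "(\<integral>\<omega>. h (Z \<omega>) * Y \<omega> \<partial>P) \<le> (\<integral>\<omega>. sign_pm (\<eta> \<omega>) * Y \<omega> \<partial>P)"
      using corr[OF hF] corr[OF sign_F] pm by (simp add: sign_pm_def)
    moreover have "misclassification_risk P Y (\<lambda>\<omega>. h (Z \<omega>)) = (1 - (\<integral>\<omega>. h (Z \<omega>) * Y \<omega> \<partial>P)) / 2"
      by (rule misclassification_risk_correlation[OF prob_space_axioms Y]) (use pm in auto)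
    moreover have "misclassification_risk P Y (\<lambda>\<omega>. sign_pm (\<eta> \<omega>))
        = (1 - (\<integral>\<omega>. sign_pm (\<eta> \<omega>) * Y \<omega> \<partial>P)) / 2"
      by (rule misclassification_risk_correlation[OF prob_space_axioms Y]) (auto simp: sign_pm_def)
    ultimately show ?thesis
      unfolding bayes Z_def[symmetric] by simp
  qed
  have "{\<omega> \<in> space F. \<eta> \<omega> \<ge> 0} \<in> sets F"
    by measurable
  then have "{\<omega> \<in> space P. \<eta> \<omega> \<ge> 0} \<in> sets F"
    using sub unfolding subalgebra_def by metis
  then obtain A where A: "A \<in> sets observation_space" "{\<omega> \<in> space P. \<eta> \<omega> \<ge> 0} = Z -` A \<inter> space P"
    using measurable_space[OF Z] by (auto simp: F_def sets_vimage_algebra2)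
  define h where "h z = (if z \<in> A then 1 else - 1 :: real)" for z
  have "h \<in> borel_measurable observation_space"
    unfolding h_def using A(1) by measurable
  then have "classifier h"
    by (auto simp: classifier_def h_def)
  moreover have "h (Z \<omega>) = sign_pm (\<eta> \<omega>)" if "\<omega> \<in> space P" for \<omega>
    using A(2) that by (auto simp: h_def sign_pm_def)
  then have "misclassification_risk P Y (\<lambda>\<omega>. h (Z \<omega>)) = misclassification_risk P Y (\<lambda>\<omega>. sign_pm (\<eta> \<omega>))"
    by (simp add: misclassification_risk_def cong: conj_cong)
  ultimately show "\<exists>h. classifier h \<and> misclassification_risk P Y (\<lambda>\<omega>. h (observe (X \<omega>) (M \<omega>)))
      = misclassification_risk P Y (bayes_prediction P X M Y)"
    unfolding bayes Z_def[symmetric] by blast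
qed


section \<open>Risk under an independent mask\<close>

lemma class_conditional_gaussian:
  assumes "prob_space P" and E [measurable]: "E \<in> sets P" and half: "measure P E = 1/2"
    and X [measurable]: "X \<in> measurable P borel"
    and dist: "distributed (uniform_measure P E) lborel X (\<lambda>x. ennreal (mvn_density \<mu> \<Sigma> x))"
    and A [measurable]: "A \<in> sets borel"
  shows "measure P {\<omega> \<in> E. X \<omega> \<in> A} = measure (gaussian \<Sigma> \<mu>) A / 2"
proof -
  interpret prob_space P by fact
  have EX: "E \<inter> (X -` A \<inter> space P) = {\<omega> \<in> E. X \<omega> \<in> A}"
    using sets.sets_into_space[OF E] by auto
  have "measure (gaussian \<Sigma> \<mu>) A = measure (distr (uniform_measure P E) lborel X) A"
    unfolding gaussian_def distributed_distr_eq_density[OF dist] ..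
  also have "\<dots> = measure (uniform_measure P E) (X -` A \<inter> space P)"
    by (subst measure_distr) auto
  also have "\<dots> = measure P {\<omega> \<in> E. X \<omega> \<in> A} / measure P E"
    using half by (subst measure_uniform_measure) (auto simp: emeasure_eq_measure EX)
  finally show ?thesis
    by (simp add: half)
qed

lemma lda_mcar_half:
  assumes lda: "lda_mcar P X M Y \<mu>\<^sub>1 \<mu>\<^sub>m\<^sub>1 \<Sigma>"
  shows "measure P {\<omega> \<in> space P. Y \<omega> = 1} = 1/2" "measure P {\<omega> \<in> space P. Y \<omega> = -1} = 1/2"
proof -
  interpret prob_space P
    using lda by (simp add: lda_mcar_def)
  have Y: "Y \<in> measurable P (count_space {-1, 1})"
    using lda by (simp add: lda_mcar_def)
  have [measurable]: "Y \<in> borel_measurable P"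
    using Y by (rule measurable_label)
  have "{\<omega> \<in> space P. Y \<omega> = 1} \<union> {\<omega> \<in> space P. Y \<omega> = -1} = space P"
    using measurable_space[OF Y] by auto
  moreover have "prob ({\<omega> \<in> space P. Y \<omega> = 1} \<union> {\<omega> \<in> space P. Y \<omega> = -1})
      = prob {\<omega> \<in> space P. Y \<omega> = 1} + prob {\<omega> \<in> space P. Y \<omega> = -1}"
    by (rule finite_measure_Union) auto
  ultimately have "prob {\<omega> \<in> space P. Y \<omega> = 1} + prob {\<omega> \<in> space P. Y \<omega> = -1} = 1"
    by (simp add: prob_space)
  moreover have "prob {\<omega> \<in> space P. Y \<omega> = 1} = prob {\<omega> \<in> space P. Y \<omega> = -1}"
    using lda by (simp add: lda_mcar_def)
  ultimately show "prob {\<omega> \<in> space P. Y \<omega> = 1} = 1/2" "prob {\<omega> \<in> space P. Y \<omega> = -1} = 1/2"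
    by auto
qed

definition region :: "('d::finite observation \<Rightarrow> real) \<Rightarrow> bool^'d \<Rightarrow> (real^'d) set" where
  "region h m = {x. h (observe x m) = 1}"

lemma sets_region: "classifier h \<Longrightarrow> region h m \<in> sets borel"
  unfolding region_def by (rule classifier_region)

text \<open>
  Independence of the mask from \<open>(X, Y)\<close> splits the risk into one term for each mask, and each term is the
  error of a classifier of two equally likely Gaussian classes.
\<close>
lemma lda_mcar_risk:
  assumes spd: "symmetric_positive_definite \<Sigma>"
    and lda: "lda_mcar P X M Y \<mu>\<^sub>1 \<mu>\<^sub>m\<^sub>1 \<Sigma>" and h: "classifier h"
  shows "misclassification_risk P Y (\<lambda>\<omega>. h (observe (X \<omega>) (M \<omega>))) =
    (\<Sum>m\<in>UNIV. measure P {\<omega> \<in> space P. M \<omega> = m} * ((1 - class_gap \<Sigma> \<mu>\<^sub>1 \<mu>\<^sub>m\<^sub>1 (region h m)) / 2))"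
proof -
  interpret prob_space P
    using lda by (simp add: lda_mcar_def)
  have X [measurable]: "X \<in> measurable P borel"
    and M [measurable]: "M \<in> measurable P (count_space UNIV)"
    and Y: "Y \<in> measurable P (count_space {-1, 1})"
    and dist: "distributed (uniform_measure P {\<omega> \<in> space P. Y \<omega> = 1}) lborel X (\<lambda>x. ennreal (mvn_density \<mu>\<^sub>1 \<Sigma> x))"
      "distributed (uniform_measure P {\<omega> \<in> space P. Y \<omega> = -1}) lborel X (\<lambda>x. ennreal (mvn_density \<mu>\<^sub>m\<^sub>1 \<Sigma> x))"
    and indep: "indep_set (sets (vimage_algebra (space P) M (count_space UNIV)))
       (sets (vimage_algebra (space P) (\<lambda>\<omega>. (X \<omega>, Y \<omega>)) (borel \<Otimes>\<^sub>M count_space {-1, 1})))"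
    using lda by (simp_all add: lda_mcar_def)
  have [measurable]: "Y \<in> borel_measurable P"
    using Y by (rule measurable_label)
  note R [measurable] = sets_region[OF h]
  have Y_cases: "Y \<omega> = 1 \<or> Y \<omega> = -1" if "\<omega> \<in> space P" for \<omega>
    using measurable_space[OF Y that] by auto
  define E where "E m = {\<omega> \<in> space P. Y \<omega> = 1 \<and> X \<omega> \<notin> region h m} \<union>
    {\<omega> \<in> space P. Y \<omega> = -1 \<and> X \<omega> \<in> region h m}" for m
  have E_meas [measurable]: "E m \<in> sets P" for m
    unfolding E_def by measurable
  have prob_E: "prob (E m) = (1 - class_gap \<Sigma> \<mu>\<^sub>1 \<mu>\<^sub>m\<^sub>1 (region h m)) / 2" for m
  proof -
    interpret G: prob_space "gaussian \<Sigma> \<mu>\<^sub>1"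
      using spd by (rule prob_space_gaussian)
    have "prob (E m) = prob {\<omega> \<in> {\<omega> \<in> space P. Y \<omega> = 1}. X \<omega> \<in> - region h m} +
        prob {\<omega> \<in> {\<omega> \<in> space P. Y \<omega> = -1}. X \<omega> \<in> region h m}"
      unfolding E_def by (subst finite_measure_Union) (auto simp: conj_assoc)
    also have "\<dots> = measure (gaussian \<Sigma> \<mu>\<^sub>1) (- region h m) / 2 + measure (gaussian \<Sigma> \<mu>\<^sub>m\<^sub>1) (region h m) / 2"
      using class_conditional_gaussian[OF prob_space_axioms _ lda_mcar_half(1)[OF lda] X dist(1), of "- region h m"]
        class_conditional_gaussian[OF prob_space_axioms _ lda_mcar_half(2)[OF lda] X dist(2) R[of m]]
      by simp
    also have "measure (gaussian \<Sigma> \<mu>\<^sub>1) (- region h m) = 1 - measure (gaussian \<Sigma> \<mu>\<^sub>1) (region h m)"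
      using G.prob_compl[of "region h m"] R by (simp add: Compl_eq_Diff_UNIV)
    finally show ?thesis
      by (simp add: class_gap_def field_simps)
  qed
  have prod: "prob ({\<omega> \<in> space P. M \<omega> = m} \<inter> E m) = prob {\<omega> \<in> space P. M \<omega> = m} * prob (E m)" for m
  proof (rule indep_setD[OF indep])
    show "{\<omega> \<in> space P. M \<omega> = m} \<in> sets (vimage_algebra (space P) M (count_space UNIV))"
      by (subst sets_vimage_algebra2) (auto intro!: image_eqI[of _ _ "{m}"])
    let ?S = "(- region h m) \<times> {1} \<union> region h m \<times> {-1 :: real}"
    have "?S \<in> sets (borel \<Otimes>\<^sub>M count_space {-1, 1})"
      using R[of m] by (intro sets.Un pair_measureI) auto
    then have "(\<lambda>\<omega>. (X \<omega>, Y \<omega>)) -` ?S \<inter> space P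
        \<in> sets (vimage_algebra (space P) (\<lambda>\<omega>. (X \<omega>, Y \<omega>)) (borel \<Otimes>\<^sub>M count_space {-1, 1}))"
      by (rule in_vimage_algebra)
    also have "(\<lambda>\<omega>. (X \<omega>, Y \<omega>)) -` ?S \<inter> space P = E m"
      by (auto simp: E_def)
    finally show "E m \<in> sets (vimage_algebra (space P) (\<lambda>\<omega>. (X \<omega>, Y \<omega>)) (borel \<Otimes>\<^sub>M count_space {-1, 1}))" .
  qed
  have "{\<omega> \<in> space P. Y \<omega> \<noteq> h (observe (X \<omega>) (M \<omega>))} = (\<Union>m\<in>UNIV. {\<omega> \<in> space P. M \<omega> = m} \<inter> E m)"
  proof (rule set_eqI)
    fix \<omega>
    show "\<omega> \<in> {\<omega> \<in> space P. Y \<omega> \<noteq> h (observe (X \<omega>) (M \<omega>))} \<longleftrightarrow>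
        \<omega> \<in> (\<Union>m\<in>UNIV. {\<omega> \<in> space P. M \<omega> = m} \<inter> E m)"
      using Y_cases[of \<omega>] classifier_cases[OF h, of "observe (X \<omega>) (M \<omega>)"]
      by (auto simp: E_def region_def)
  qed
  moreover have "prob (\<Union>m\<in>UNIV. {\<omega> \<in> space P. M \<omega> = m} \<inter> E m)
      = (\<Sum>m\<in>UNIV. prob ({\<omega> \<in> space P. M \<omega> = m} \<inter> E m))"
    by (rule finite_measure_finite_Union) (auto simp: disjoint_family_on_def)
  ultimately show ?thesis
    by (simp add: misclassification_risk_def prod prob_E)
qed

text \<open>
  Optimality becomes a comparison of finite sums, without conditional expectations. As the summands for
  different masks can be chosen independently, it will be used mask by mask.
\<close>
lemma bayes_optimal_iff:
  assumes spd: "symmetric_positive_definite \<Sigma>"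
    and lda: "lda_mcar P X M Y \<mu>\<^sub>1 \<mu>\<^sub>m\<^sub>1 \<Sigma>" and h: "classifier h"
  shows "bayes_optimal P X M Y h \<longleftrightarrow> (\<forall>h'. classifier h' \<longrightarrow>
    (\<Sum>m\<in>UNIV. measure P {\<omega> \<in> space P. M \<omega> = m} * class_gap \<Sigma> \<mu>\<^sub>1 \<mu>\<^sub>m\<^sub>1 (region h' m))
    \<le> (\<Sum>m\<in>UNIV. measure P {\<omega> \<in> space P. M \<omega> = m} * class_gap \<Sigma> \<mu>\<^sub>1 \<mu>\<^sub>m\<^sub>1 (region h m)))"
proof -
  define risk where "risk h = misclassification_risk P Y (\<lambda>\<omega>. h (observe (X \<omega>) (M \<omega>)))" for h
  have base: "prob_space P" "X \<in> measurable P borel" "M \<in> measurable P (count_space UNIV)"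
    "Y \<in> measurable P (count_space {-1, 1})"
    using lda by (simp_all add: lda_mcar_def)
  have le: "misclassification_risk P Y (bayes_prediction P X M Y) \<le> risk h'" if "classifier h'" for h'
    unfolding risk_def using base that by (rule bayes_prediction_le)
  obtain h\<^sub>0 where "classifier h\<^sub>0" "risk h\<^sub>0 = misclassification_risk P Y (bayes_prediction P X M Y)"
    using bayes_prediction_attained[OF base] unfolding risk_def by blast
  then have "bayes_optimal P X M Y h \<longleftrightarrow> (\<forall>h'. classifier h' \<longrightarrow> risk h \<le> risk h')"
    using le le[OF h] unfolding bayes_optimal_def risk_def[symmetric] by fastforce
  moreover have "risk h' = (\<Sum>m\<in>UNIV. measure P {\<omega> \<in> space P. M \<omega> = m} / 2)
      - (\<Sum>m\<in>UNIV. measure P {\<omega> \<in> space P. M \<omega> = m} * class_gap \<Sigma> \<mu>\<^sub>1 \<mu>\<^sub>m\<^sub>1 (region h' m)) / 2"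
    if "classifier h'" for h'
  proof -
    have split: "p * ((1 - g) / 2) = p / 2 - p * g / 2" for p g :: real
      by (simp add: algebra_simps diff_divide_distrib)
    show ?thesis
      unfolding risk_def lda_mcar_risk[OF spd lda that] split sum_subtractf sum_divide_distrib ..
  qed
  ultimately show ?thesis
    using h by simp
qed


section \<open>Existence of the model\<close>

definition labelled_gaussian :: "real^'d^'d \<Rightarrow> real^'d \<Rightarrow> real^'d \<Rightarrow> ((real^'d) \<times> real) measure" where
  "labelled_gaussian \<Sigma> \<mu>\<^sub>1 \<mu>\<^sub>m\<^sub>1 = density (lborel \<Otimes>\<^sub>M count_space {-1, 1})
     (\<lambda>p. ennreal (1/2) * ennreal (mvn_density (if snd p = 1 then \<mu>\<^sub>1 else \<mu>\<^sub>m\<^sub>1) \<Sigma> (fst p)))"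

lemma sets_labelled_gaussian [measurable_cong, simp]:
  "sets (labelled_gaussian \<Sigma> \<mu>\<^sub>1 \<mu>\<^sub>m\<^sub>1) = sets (borel \<Otimes>\<^sub>M count_space {-1, 1})"
  by (auto simp: labelled_gaussian_def intro!: sets_pair_measure_cong)

lemma space_labelled_gaussian [simp]:
  "space (labelled_gaussian \<Sigma> \<mu>\<^sub>1 \<mu>\<^sub>m\<^sub>1) = UNIV \<times> {-1, 1}"
  by (simp add: labelled_gaussian_def space_pair_measure)

lemma emeasure_labelled_gaussian:
  assumes E: "E \<in> sets (borel \<Otimes>\<^sub>M count_space {-1, 1})"
  shows "emeasure (labelled_gaussian \<Sigma> \<mu>\<^sub>1 \<mu>\<^sub>m\<^sub>1) E = ennreal (1/2) *
    (emeasure (gaussian \<Sigma> \<mu>\<^sub>m\<^sub>1) ((\<lambda>x. (x, -1)) -` E) + emeasure (gaussian \<Sigma> \<mu>\<^sub>1) ((\<lambda>x. (x, 1)) -` E))"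
proof -
  interpret C: sigma_finite_measure "count_space {-1, 1 :: real}"
    by (rule sigma_finite_measure_count_space_finite) simp
  have E' [measurable]: "E \<in> sets (lborel \<Otimes>\<^sub>M count_space {-1, 1})"
    using E by (simp cong: sets_pair_measure_cong)
  have sec [measurable]: "(\<lambda>x. (x, y)) -` E \<in> sets borel" if "y \<in> {-1, 1}" for y
    using sets_Pair2[OF E, of y] by simp
  let ?f = "\<lambda>p. ennreal (1/2) * ennreal (mvn_density (if snd p = 1 then \<mu>\<^sub>1 else \<mu>\<^sub>m\<^sub>1) \<Sigma> (fst p))"
  have [measurable]: "?f \<in> borel_measurable (lborel \<Otimes>\<^sub>M count_space {-1, 1})"
  proof -
    have "(\<lambda>p. if snd p = 1 then ennreal (mvn_density \<mu>\<^sub>1 \<Sigma> (fst p)) else ennreal (mvn_density \<mu>\<^sub>m\<^sub>1 \<Sigma> (fst p)))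
        \<in> borel_measurable (lborel \<Otimes>\<^sub>M count_space {-1, 1 :: real})"
      by measurable
    moreover have "(\<lambda>p. if snd p = 1 then ennreal (mvn_density \<mu>\<^sub>1 \<Sigma> (fst p)) else ennreal (mvn_density \<mu>\<^sub>m\<^sub>1 \<Sigma> (fst p)))
        = (\<lambda>p. ennreal (mvn_density (if snd p = (1 :: real) then \<mu>\<^sub>1 else \<mu>\<^sub>m\<^sub>1) \<Sigma> (fst p)))"
      by auto
    ultimately show ?thesis
      by simp
  qed
  have "emeasure (labelled_gaussian \<Sigma> \<mu>\<^sub>1 \<mu>\<^sub>m\<^sub>1) E
      = (\<integral>\<^sup>+p. ?f p * indicator E p \<partial>(lborel \<Otimes>\<^sub>M count_space {-1, 1}))"
    unfolding labelled_gaussian_def by (rule emeasure_density) measurable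
  also have "\<dots> = (\<integral>\<^sup>+x. \<integral>\<^sup>+y. ?f (x, y) * indicator E (x, y) \<partial>count_space {-1, 1} \<partial>lborel)"
    by (rule C.nn_integral_fst[symmetric]) measurable
  also have "\<dots> = (\<integral>\<^sup>+x. ennreal (1/2) * (ennreal (mvn_density \<mu>\<^sub>m\<^sub>1 \<Sigma> x) * indicator ((\<lambda>x. (x, -1)) -` E) x
      + ennreal (mvn_density \<mu>\<^sub>1 \<Sigma> x) * indicator ((\<lambda>x. (x, 1)) -` E) x) \<partial>lborel)"
    by (intro nn_integral_cong)
      (auto simp: nn_integral_count_space_finite indicator_def distrib_left)
  also have "\<dots> = ennreal (1/2) * ((\<integral>\<^sup>+x. ennreal (mvn_density \<mu>\<^sub>m\<^sub>1 \<Sigma> x) * indicator ((\<lambda>x. (x, -1)) -` E) x \<partial>lborel)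
      + (\<integral>\<^sup>+x. ennreal (mvn_density \<mu>\<^sub>1 \<Sigma> x) * indicator ((\<lambda>x. (x, 1)) -` E) x \<partial>lborel))"
    using sec by (simp add: nn_integral_cmult nn_integral_add)
  also have "\<dots> = ennreal (1/2) *
    (emeasure (gaussian \<Sigma> \<mu>\<^sub>m\<^sub>1) ((\<lambda>x. (x, -1)) -` E) + emeasure (gaussian \<Sigma> \<mu>\<^sub>1) ((\<lambda>x. (x, 1)) -` E))"
    using sec by (simp add: gaussian_def emeasure_density)
  finally show ?thesis .
qed

lemma prob_space_labelled_gaussian:
  assumes spd: "symmetric_positive_definite \<Sigma>"
  shows "prob_space (labelled_gaussian \<Sigma> \<mu>\<^sub>1 \<mu>\<^sub>m\<^sub>1)"
proof (rule prob_spaceI)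
  have U: "UNIV \<times> {-1, 1 :: real} \<in> sets (borel \<Otimes>\<^sub>M count_space {-1, 1})"
    by (rule pair_measureI) auto
  have "emeasure (gaussian \<Sigma> \<mu>) UNIV = 1" for \<mu>
    using prob_space.emeasure_space_1[OF prob_space_gaussian[OF spd]] by simp
  moreover have "ennreal (1/2) * (1 + 1) = 1"
    using ennreal_mult[of "1/2" 2] by simp
  ultimately show "emeasure (labelled_gaussian \<Sigma> \<mu>\<^sub>1 \<mu>\<^sub>m\<^sub>1) (space (labelled_gaussian \<Sigma> \<mu>\<^sub>1 \<mu>\<^sub>m\<^sub>1)) = 1"
    unfolding space_labelled_gaussian emeasure_labelled_gaussian[OF U] by (simp add: vimage_def)
qed

lemma measure_labelled_gaussian:
  assumes spd: "symmetric_positive_definite \<Sigma>" and A: "A \<in> sets borel"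
  shows "measure (labelled_gaussian \<Sigma> \<mu>\<^sub>1 \<mu>\<^sub>m\<^sub>1) (A \<times> {1}) = measure (gaussian \<Sigma> \<mu>\<^sub>1) A / 2"
    and "measure (labelled_gaussian \<Sigma> \<mu>\<^sub>1 \<mu>\<^sub>m\<^sub>1) (A \<times> {-1}) = measure (gaussian \<Sigma> \<mu>\<^sub>m\<^sub>1) A / 2"
proof -
  have S: "A \<times> {y} \<in> sets (borel \<Otimes>\<^sub>M count_space {-1, 1 :: real})" if "y \<in> {-1, 1}" for y
    using A that by (intro pair_measureI) auto
  have eq: "(\<lambda>x. (x, 1 :: real)) -` (A \<times> {1}) = A" "(\<lambda>x. (x, - 1 :: real)) -` (A \<times> {-1}) = A"
    "(\<lambda>x. (x, 1 :: real)) -` (A \<times> {-1}) = {}" "(\<lambda>x. (x, - 1 :: real)) -` (A \<times> {1}) = {}"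
    by auto
  have half: "enn2real (ennreal (1/2) * r) = enn2real r / 2" for r
    unfolding enn2real_mult by (subst enn2real_ennreal) auto
  show "measure (labelled_gaussian \<Sigma> \<mu>\<^sub>1 \<mu>\<^sub>m\<^sub>1) (A \<times> {1}) = measure (gaussian \<Sigma> \<mu>\<^sub>1) A / 2"
    unfolding measure_def emeasure_labelled_gaussian[OF S[of 1, simplified]] half eq by simp
  show "measure (labelled_gaussian \<Sigma> \<mu>\<^sub>1 \<mu>\<^sub>m\<^sub>1) (A \<times> {-1}) = measure (gaussian \<Sigma> \<mu>\<^sub>m\<^sub>1) A / 2"
    unfolding measure_def emeasure_labelled_gaussian[OF S[of "-1", simplified]] half eq by simp
qed

text \<open>
  The pair \<open>(X, Y)\<close> is drawn from the mixture with density \<open>1/2\<close> times that of the class, and the mask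
  independently from \<open>\<nu>\<close>.
\<close>
lemma lda_mcar_exists:
  fixes \<Sigma> :: "real^'d^'d" and \<nu> :: "(bool^'d) pmf"
  assumes spd: "symmetric_positive_definite \<Sigma>"
  obtains P :: "((real^'d) \<times> (bool^'d) \<times> real) measure" where
    "lda_mcar P (\<lambda>(x, m, y). x) (\<lambda>(x, m, y). m) (\<lambda>(x, m, y). y) \<mu>\<^sub>1 \<mu>\<^sub>m\<^sub>1 \<Sigma>"
    "distr P (count_space UNIV) (\<lambda>(x, m, y). m) = measure_pmf \<nu>"
proof -
  let ?R = "labelled_gaussian \<Sigma> \<mu>\<^sub>1 \<mu>\<^sub>m\<^sub>1" and ?N = "measure_pmf \<nu>"
  let ?S = "borel \<Otimes>\<^sub>M count_space UNIV \<Otimes>\<^sub>M count_space {-1, 1} :: ((real^'d) \<times> (bool^'d) \<times> real) measure"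
  let ?X = "\<lambda>(x, m, y). x :: real^'d" and ?M = "\<lambda>(x, m, y). m :: bool^'d" and ?Y = "\<lambda>(x, m, y). y :: real"
  define T where "T q = (fst (fst q), snd q, snd (fst q))" for q :: "((real^'d) \<times> real) \<times> (bool^'d)"
  define P where "P = distr (?R \<Otimes>\<^sub>M ?N) ?S T"
  interpret R: prob_space ?R
    using spd by (rule prob_space_labelled_gaussian)
  interpret RN: pair_prob_space ?R ?N ..
  have T [measurable]: "T \<in> measurable (?R \<Otimes>\<^sub>M ?N) ?S"
    unfolding T_def by measurable
  interpret prob_space P
    unfolding P_def using T by (rule RN.prob_space_distr)
  have sets_P [measurable_cong]: "sets P = sets ?S" and space_P: "space P = UNIV \<times> UNIV \<times> {-1, 1}"
    by (auto simp: P_def space_pair_measure)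
  have X [measurable]: "?X \<in> measurable P borel" and M [measurable]: "?M \<in> measurable P (count_space UNIV)"
    and Y [measurable]: "?Y \<in> measurable P (count_space {-1, 1})"
    by measurable
  have rect: "prob {\<omega> \<in> space P. ?M \<omega> \<in> B \<and> (?X \<omega>, ?Y \<omega>) \<in> E} = measure ?R E * measure ?N B"
    if E: "E \<in> sets (borel \<Otimes>\<^sub>M count_space {-1, 1})" for E B
  proof -
    have [measurable]: "(\<lambda>\<omega>. (?X \<omega>, ?Y \<omega>)) \<in> measurable P (borel \<Otimes>\<^sub>M count_space {-1, 1})"
      by measurable
    have "{\<omega> \<in> space P. ?M \<omega> \<in> B \<and> (?X \<omega>, ?Y \<omega>) \<in> E} \<in> sets P"
      using E by measurable
    then have "prob {\<omega> \<in> space P. ?M \<omega> \<in> B \<and> (?X \<omega>, ?Y \<omega>) \<in> E}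
        = measure (?R \<Otimes>\<^sub>M ?N) (T -` {\<omega> \<in> space P. ?M \<omega> \<in> B \<and> (?X \<omega>, ?Y \<omega>) \<in> E} \<inter> space (?R \<Otimes>\<^sub>M ?N))"
      unfolding P_def by (subst measure_distr) auto
    also have "T -` {\<omega> \<in> space P. ?M \<omega> \<in> B \<and> (?X \<omega>, ?Y \<omega>) \<in> E} \<inter> space (?R \<Otimes>\<^sub>M ?N) = E \<times> B"
      using sets.sets_into_space[OF E] by (auto simp: T_def space_pair_measure space_P)
    also have "measure (?R \<Otimes>\<^sub>M ?N) (E \<times> B) = measure ?R E * measure ?N B"
      using E by (simp add: measure_def measure_pmf.emeasure_pair_measure_Times enn2real_mult)
    finally show ?thesis .
  qed
  have full: "UNIV \<times> {-1, 1 :: real} \<in> sets (borel \<Otimes>\<^sub>M count_space {-1, 1})"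
    by (rule pair_measureI) auto
  have XY: "prob {\<omega> \<in> space P. (?X \<omega>, ?Y \<omega>) \<in> E} = measure ?R E"
    if "E \<in> sets (borel \<Otimes>\<^sub>M count_space {-1, 1})" for E
    using rect[OF that, of UNIV] by simp
  have Mlaw: "prob {\<omega> \<in> space P. ?M \<omega> \<in> B} = measure ?N B" for B
  proof -
    have "{\<omega> \<in> space P. ?M \<omega> \<in> B \<and> (?X \<omega>, ?Y \<omega>) \<in> UNIV \<times> {-1, 1}} = {\<omega> \<in> space P. ?M \<omega> \<in> B}"
      by (auto simp: space_P)
    then show ?thesis
      using rect[OF full, of B] R.prob_space by simp
  qed
  have cond: "distributed (uniform_measure P {\<omega> \<in> space P. ?Y \<omega> = k}) lborel ?X (\<lambda>x. ennreal (mvn_density \<mu> \<Sigma> x))"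
      "prob {\<omega> \<in> space P. ?Y \<omega> = k} = 1/2"
    if k: "k \<in> {-1, 1}" and joint: "\<And>A. A \<in> sets borel \<Longrightarrow> measure ?R (A \<times> {k}) = measure (gaussian \<Sigma> \<mu>) A / 2"
    for k \<mu>
  proof -
    let ?E = "{\<omega> \<in> space P. ?Y \<omega> = k}"
    interpret G: prob_space "gaussian \<Sigma> \<mu>"
      using spd by (rule prob_space_gaussian)
    have rect_k: "A \<times> {k} \<in> sets (borel \<Otimes>\<^sub>M count_space {-1, 1})" if "A \<in> sets borel" for A :: "(real^'d) set"
      using that k by (intro pair_measureI) auto
    have Y_borel [measurable]: "?Y \<in> borel_measurable P"
      using Y by (rule measurable_label)
    have E [measurable]: "?E \<in> sets P"
      by measurable
    have joint': "prob (?E \<inter> (?X -` A \<inter> space P)) = measure (gaussian \<Sigma> \<mu>) A / 2" if "A \<in> sets borel" for A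
    proof -
      have "?E \<inter> (?X -` A \<inter> space P) = {\<omega> \<in> space P. (?X \<omega>, ?Y \<omega>) \<in> A \<times> {k}}"
        by auto
      then show ?thesis
        using XY[OF rect_k[OF that]] joint[OF that] by simp
    qed
    then show half: "prob ?E = 1/2"
      using joint'[of UNIV] G.prob_space by (simp add: Int_def conj_ac)
    have "distr (uniform_measure P ?E) lborel ?X = gaussian \<Sigma> \<mu>"
    proof (rule measure_eqI)
      fix A assume "A \<in> sets (distr (uniform_measure P ?E) lborel ?X)"
      then have A [measurable]: "A \<in> sets borel"
        by simp
      have "emeasure (distr (uniform_measure P ?E) lborel ?X) A = emeasure P (?E \<inter> (?X -` A \<inter> space P)) / emeasure P ?E"
        by (subst emeasure_distr) (auto simp: emeasure_uniform_measure)
      also have "\<dots> = emeasure (gaussian \<Sigma> \<mu>) A"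
        unfolding emeasure_eq_measure G.emeasure_eq_measure half joint'[OF A]
        by (subst divide_ennreal) auto
      finally show "emeasure (distr (uniform_measure P ?E) lborel ?X) A = emeasure (gaussian \<Sigma> \<mu>) A" .
    qed simp
    then show "distributed (uniform_measure P ?E) lborel ?X (\<lambda>x. ennreal (mvn_density \<mu> \<Sigma> x))"
      by (simp add: distributed_def gaussian_def)
  qed
  note class_1 = cond[of 1 \<mu>\<^sub>1, OF _ measure_labelled_gaussian(1)[OF spd]]
  note class_m1 = cond[of "-1" \<mu>\<^sub>m\<^sub>1, OF _ measure_labelled_gaussian(2)[OF spd]]
  have "indep_set (sets (vimage_algebra (space P) ?M (count_space UNIV)))
      (sets (vimage_algebra (space P) (\<lambda>\<omega>. (?X \<omega>, ?Y \<omega>)) (borel \<Otimes>\<^sub>M count_space {-1, 1})))"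
    (is "indep_set (sets ?VM) (sets ?VXY)")
  proof (rule indep_setI)
    have "?M \<in> space P \<rightarrow> space (count_space UNIV)"
      and "(\<lambda>\<omega>. (?X \<omega>, ?Y \<omega>)) \<in> space P \<rightarrow> space (borel \<Otimes>\<^sub>M count_space {-1, 1})"
      by (auto simp: space_P space_pair_measure)
    note sets_V = this[THEN sets_vimage_algebra2]
    have [measurable]: "(\<lambda>\<omega>. (?X \<omega>, ?Y \<omega>)) \<in> measurable P (borel \<Otimes>\<^sub>M count_space {-1, 1})"
      by measurable
    show "sets ?VM \<subseteq> events" "sets ?VXY \<subseteq> events"
      unfolding sets_V by (auto intro!: measurable_sets[OF M] measurable_sets[of _ P "borel \<Otimes>\<^sub>M count_space {-1, 1}"])
    fix a b assume "a \<in> sets ?VM" "b \<in> sets ?VXY"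
    then obtain B E where B: "a = ?M -` B \<inter> space P" and b: "b = (\<lambda>\<omega>. (?X \<omega>, ?Y \<omega>)) -` E \<inter> space P"
      and E: "E \<in> sets (borel \<Otimes>\<^sub>M count_space {-1, 1})"
      unfolding sets_V by auto
    have "a \<inter> b = {\<omega> \<in> space P. ?M \<omega> \<in> B \<and> (?X \<omega>, ?Y \<omega>) \<in> E}"
      "a = {\<omega> \<in> space P. ?M \<omega> \<in> B}" "b = {\<omega> \<in> space P. (?X \<omega>, ?Y \<omega>) \<in> E}"
      unfolding B b by auto
    then show "prob (a \<inter> b) = prob a * prob b"
      by (simp only: rect[OF E] XY[OF E] Mlaw mult.commute)
  qed
  then have "lda_mcar P ?X ?M ?Y \<mu>\<^sub>1 \<mu>\<^sub>m\<^sub>1 \<Sigma>"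
    unfolding lda_mcar_def using prob_space_axioms X M Y class_1 class_m1 by simp
  moreover have "distr P (count_space UNIV) ?M = measure_pmf \<nu>"
  proof (rule measure_eqI)
    fix B
    have "{\<omega> \<in> space P. ?M \<omega> \<in> B} = ?M -` B \<inter> space P"
      by auto
    then show "emeasure (distr P (count_space UNIV) ?M) B = emeasure (measure_pmf \<nu>) B"
      using Mlaw[of B] by (simp add: emeasure_distr emeasure_eq_measure measure_pmf.emeasure_eq_measure)
  qed simp
  ultimately show thesis
    by (rule that)
qed


section \<open>Constant imputation\<close>

lemma sign_pm_eq_1_iff: "sign_pm t = 1 \<longleftrightarrow> 0 \<le> t"
  by (simp add: sign_pm_def)

lemma measurable_observation_component:
  "(\<lambda>z. fst z j) \<in> borel_measurable observation_space"
  and measurable_observation_mask: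
  "snd \<in> measurable observation_space (count_space UNIV)"
  unfolding observation_space_def by measurable

lemma measurable_sign_pm [measurable]: "sign_pm \<in> borel_measurable borel"
  unfolding sign_pm_def[abs_def] by measurable

lemma classifier_imputed: "classifier (imputed_classifier \<alpha> \<gamma>\<^sub>0 \<gamma>)"
proof -
  note [measurable] = measurable_observation_component
  have [measurable]: "(\<lambda>z. of_bool (P (snd z)) :: real) \<in> borel_measurable observation_space" for P
    by (rule measurable_compose[OF measurable_observation_mask]) simp
  have "imputed_classifier \<alpha> \<gamma>\<^sub>0 \<gamma> = (\<lambda>z. sign_pm (\<gamma>\<^sub>0 + (\<Sum>j\<in>UNIV. \<gamma> $ j *
      (fst z j * of_bool (\<not> snd z $ j) + \<alpha> $ j * of_bool (snd z $ j)))))"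
    by (auto simp: imputed_classifier_def)
  also have "\<dots> \<in> borel_measurable observation_space"
    by measurable
  finally show ?thesis
    by (auto simp: classifier_def imputed_classifier_def sign_pm_def split: if_splits)
qed

text \<open>
  Used to improve a classifier on a single mask by the linear rule that is optimal there.
\<close>
lemma classifier_override:
  assumes h: "classifier h"
  shows "classifier (\<lambda>z. if snd z = m then sign_pm (\<Sum>j\<in>UNIV. w j * (fst z j - c j)) else h z)"
proof -
  note [measurable] = measurable_observation_component classifier_measurable[OF h]
  have [measurable]: "Measurable.pred observation_space (\<lambda>z. snd z = m)"
    by (rule measurable_compose[OF measurable_observation_mask]) simp
  have "(\<lambda>z. if snd z = m then sign_pm (\<Sum>j\<in>UNIV. w j * (fst z j - c j)) else h z)
      \<in> borel_measurable observation_space"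
    by measurable
  then show ?thesis
    using classifier_cases[OF h] by (auto simp: classifier_def sign_pm_def)
qed

lemma region_observed:
  "(\<And>j. j \<in> obs m \<Longrightarrow> x $ j = y $ j) \<Longrightarrow> x \<in> region h m \<longleftrightarrow> y \<in> region h m"
proof -
  assume "\<And>j. j \<in> obs m \<Longrightarrow> x $ j = y $ j"
  then have "observe x m = observe y m"
    by (auto simp: observe_def restrict_def)
  then show ?thesis
    by (simp add: region_def)
qed

lemma region_imputed:
  "region (imputed_classifier \<alpha> \<gamma>\<^sub>0 \<gamma>) m =
    {x. 0 \<le> \<gamma>\<^sub>0 + (\<Sum>j\<in>UNIV. \<gamma> $ j * (if j \<in> obs m then x $ j else \<alpha> $ j))}"
proof -
  have "\<gamma> $ j * (restrict (($) x) (obs m) j * of_bool (\<not> m $ j) + \<alpha> $ j * of_bool (m $ j))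
      = \<gamma> $ j * (if j \<in> obs m then x $ j else \<alpha> $ j)" for x j
    by (auto simp: obs_def)
  then show ?thesis
    unfolding region_def imputed_classifier_def observe_def by (simp only: prod.case sign_pm_eq_1_iff)
qed

text \<open>
  For diagonal \<open>\<Sigma>\<close> the optimal weights on a mask are the restriction of the vector
  \<open>\<gamma>\<^sub>j = (\<mu>\<^sub>1\<^sub>j - \<mu>\<^sub>m\<^sub>1\<^sub>j) / \<Sigma>\<^sub>j\<^sub>j\<close> to the observed coordinates. The optimal score is the sum of
  \<open>\<gamma>\<^sub>j (x\<^sub>j - \<alpha>\<^sub>j)\<close> over these coordinates, with \<open>\<alpha>\<close> the midpoint of the means, and imputing
  \<open>\<alpha>\<^sub>j\<close> makes the missing coordinates contribute zero.
\<close>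
lemma midpoint_imputation_optimal:
  fixes \<Sigma> :: "real^'d^'d"
  assumes spd: "symmetric_positive_definite \<Sigma>" and diag: "diagonal_matrix \<Sigma>"
  shows "optimal_imputation laws \<mu>\<^sub>1 \<mu>\<^sub>m\<^sub>1 \<Sigma> (\<chi> j. (\<mu>\<^sub>1 $ j + \<mu>\<^sub>m\<^sub>1 $ j) / 2)"
proof -
  define \<gamma> :: "real^'d" where "\<gamma> = (\<chi> j. (\<mu>\<^sub>1 $ j - \<mu>\<^sub>m\<^sub>1 $ j) / \<Sigma> $ j $ j)"
  define \<alpha> :: "real^'d" where "\<alpha> = (\<chi> j. (\<mu>\<^sub>1 $ j + \<mu>\<^sub>m\<^sub>1 $ j) / 2)"
  define \<gamma>\<^sub>0 where "\<gamma>\<^sub>0 = - (\<Sum>j\<in>UNIV. \<gamma> $ j * \<alpha> $ j)"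
  let ?h = "imputed_classifier \<alpha> \<gamma>\<^sub>0 \<gamma>"
  have \<Sigma>_diag: "(\<Sigma> *v w) $ j = \<Sigma> $ j $ j * w $ j" for w j
    using diag unfolding matrix_vector_mult_def diagonal_matrix_def
    by (subst vec_lambda_beta, subst sum.remove[of _ j]) auto
  have \<Sigma>_pos: "\<Sigma> $ j $ j > 0" for j
    using symmetric_positive_definiteD(2)[OF spd, of "axis j 1"]
    by (simp add: inner_axis' \<Sigma>_diag axis_nth axis_eq_0_iff)
  have gap: "class_gap \<Sigma> \<mu>\<^sub>1 \<mu>\<^sub>m\<^sub>1 (region h m) \<le> class_gap \<Sigma> \<mu>\<^sub>1 \<mu>\<^sub>m\<^sub>1 (region ?h m)"
    if h: "classifier h" for h m
  proof -
    define w :: "real^'d" where "w = (\<chi> j. if j \<in> obs m then \<gamma> $ j else 0)"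
    have "\<gamma>\<^sub>0 + (\<Sum>j\<in>UNIV. \<gamma> $ j * (if j \<in> obs m then x $ j else \<alpha> $ j))
        = (\<Sum>j\<in>UNIV. w $ j * (x $ j - (\<mu>\<^sub>1 $ j + \<mu>\<^sub>m\<^sub>1 $ j) / 2))" for x
    proof -
      have "(\<Sum>j\<in>UNIV. w $ j * (x $ j - (\<mu>\<^sub>1 $ j + \<mu>\<^sub>m\<^sub>1 $ j) / 2))
          = (\<Sum>j\<in>UNIV. \<gamma> $ j * (if j \<in> obs m then x $ j else \<alpha> $ j) - \<gamma> $ j * \<alpha> $ j)"
        by (intro sum.cong) (auto simp: w_def \<alpha>_def algebra_simps)
      then show ?thesis
        by (simp add: sum_subtractf \<gamma>\<^sub>0_def)
    qed
    then have "region ?h m = {x. 0 \<le> (\<Sum>j\<in>UNIV. w $ j * (x $ j - (\<mu>\<^sub>1 $ j + \<mu>\<^sub>m\<^sub>1 $ j) / 2))}"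
      by (simp add: region_imputed)
    moreover have "class_gap \<Sigma> \<mu>\<^sub>1 \<mu>\<^sub>m\<^sub>1 (region h m) \<le>
        class_gap \<Sigma> \<mu>\<^sub>1 \<mu>\<^sub>m\<^sub>1 {x. 0 \<le> (\<Sum>j\<in>UNIV. w $ j * (x $ j - (\<mu>\<^sub>1 $ j + \<mu>\<^sub>m\<^sub>1 $ j) / 2))}"
    proof (rule class_gap_observed_halfspace(1)[OF spd, where J = "obs m"])
      show "(\<Sigma> *v w) $ j = \<mu>\<^sub>1 $ j - \<mu>\<^sub>m\<^sub>1 $ j" if "j \<in> obs m" for j
        using that \<Sigma>_pos[of j] by (simp add: \<Sigma>_diag w_def \<gamma>_def)
    qed (auto simp: w_def sets_region[OF h] intro!: region_observed)
    ultimately show ?thesis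
      by simp
  qed
  have "bayes_optimal P X M Y ?h" if "lda_mcar P X M Y \<mu>\<^sub>1 \<mu>\<^sub>m\<^sub>1 \<Sigma>"
    for P :: "((real^'d) \<times> (bool^'d) \<times> real) measure" and X M Y
    unfolding bayes_optimal_iff[OF spd that classifier_imputed]
    by (intro allI impI sum_mono mult_left_mono gap) auto
  then show ?thesis
    unfolding optimal_imputation_def Let_def \<alpha>_def by blast
qed

text \<open>
  A Bayes optimal classifier agrees with the optimal half-space on each mask of positive probability, up to
  sets without interior. Otherwise replacing its values on this mask alone would lower the risk.
\<close>
lemma bayes_optimal_on_mask:
  fixes w \<mu>\<^sub>1 \<mu>\<^sub>m\<^sub>1 :: "real^'d"
  defines "l x \<equiv> \<Sum>j\<in>UNIV. w $ j * (x $ j - (\<mu>\<^sub>1 $ j + \<mu>\<^sub>m\<^sub>1 $ j) / 2)"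
  assumes spd: "symmetric_positive_definite \<Sigma>"
    and lda: "lda_mcar P X M Y \<mu>\<^sub>1 \<mu>\<^sub>m\<^sub>1 \<Sigma>" and h: "classifier h"
    and opt: "bayes_optimal P X M Y h"
    and m: "measure P {\<omega> \<in> space P. M \<omega> = m} > 0"
    and supp: "\<And>j. j \<notin> obs m \<Longrightarrow> w $ j = 0"
    and w: "\<And>j. j \<in> obs m \<Longrightarrow> (\<Sigma> *v w) $ j = \<mu>\<^sub>1 $ j - \<mu>\<^sub>m\<^sub>1 $ j"
    and U: "open U" "\<And>x. x \<in> U \<Longrightarrow> if x \<in> region h m then l x < 0 else l x > 0"
  shows "U = {}"
proof -
  let ?p = "\<lambda>m. measure P {\<omega> \<in> space P. M \<omega> = m}" and ?gap = "class_gap \<Sigma> \<mu>\<^sub>1 \<mu>\<^sub>m\<^sub>1"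
  define h' where "h' z = (if snd z = m
    then sign_pm (\<Sum>j\<in>UNIV. w $ j * (fst z j - (\<mu>\<^sub>1 $ j + \<mu>\<^sub>m\<^sub>1 $ j) / 2)) else h z)" for z
  have h': "classifier h'"
    unfolding h'_def using h by (rule classifier_override)
  have "(\<Sum>j\<in>UNIV. w $ j * (restrict (($) x) (obs m) j - (\<mu>\<^sub>1 $ j + \<mu>\<^sub>m\<^sub>1 $ j) / 2)) = l x" for x
    unfolding l_def
  proof (rule sum.cong)
    fix j
    show "w $ j * (restrict (($) x) (obs m) j - (\<mu>\<^sub>1 $ j + \<mu>\<^sub>m\<^sub>1 $ j) / 2)
        = w $ j * (x $ j - (\<mu>\<^sub>1 $ j + \<mu>\<^sub>m\<^sub>1 $ j) / 2)"
      using supp[of j] by (cases "j \<in> obs m") auto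
  qed simp
  then have on: "region h' m = {x. 0 \<le> l x}"
    by (simp add: region_def h'_def observe_def sign_pm_eq_1_iff)
  have off: "region h' m' = region h m'" if "m' \<noteq> m" for m'
    using that by (simp add: region_def h'_def observe_def)
  have "(\<Sum>m\<in>UNIV. ?p m * ?gap (region h' m)) \<le> (\<Sum>m\<in>UNIV. ?p m * ?gap (region h m))"
    using opt h' by (simp add: bayes_optimal_iff[OF spd lda h])
  then have "?p m * ?gap (region h' m) \<le> ?p m * ?gap (region h m)"
    by (simp add: sum.remove[of UNIV m] off)
  then have "?gap {x. 0 \<le> l x} \<le> ?gap (region h m)"
    using m by (simp add: on)
  moreover have observed: "x \<in> region h m \<longleftrightarrow> y \<in> region h m"
    if "\<And>j. j \<in> obs m \<Longrightarrow> x $ j = y $ j" for x y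
    using that by (rule region_observed)
  note halfspace = class_gap_observed_halfspace[where J = "obs m", OF spd supp w sets_region[OF h] observed, folded l_def]
  have "?gap (region h m) \<le> ?gap {x. 0 \<le> l x}"
    by (rule halfspace(1)) blast+
  ultimately have "?gap (region h m) = ?gap {x. 0 \<le> l x}"
    by simp
  show ?thesis
    by (rule halfspace(2)) (fact | rule U | blast)+
qed

text \<open>
  The means \<open>\<plusminus>\<Sigma> e\<^sub>i\<close> are chosen so that for complete data the optimal rule is the sign of \<open>x\<^sub>i\<close>. This forces
  \<open>\<gamma>\<^sub>j = 0\<close>, so an imputed classifier is constant when only coordinate \<open>j\<close> is observed. But if
  \<open>\<Sigma>\<^sub>j\<^sub>i \<noteq> 0\<close>, then the class means \<open>\<plusminus>\<Sigma>\<^sub>j\<^sub>i\<close> of this coordinate differ, and no constant rule is optimal.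
\<close>
lemma constant_imputation_optimal_imp_uncorrelated:
  fixes \<Sigma> :: "real^'d^'d"
  assumes spd: "symmetric_positive_definite \<Sigma>" and \<nu>: "\<And>m. pmf \<nu> m > 0"
    and opt: "constant_imputation_optimal {\<nu>} (\<Sigma> *v axis i 1) (- (\<Sigma> *v axis i 1)) \<Sigma>"
    and ij: "i \<noteq> j"
  shows "\<Sigma> $ j $ i = 0"
proof (rule ccontr)
  assume nz: "\<Sigma> $ j $ i \<noteq> 0"
  let ?\<mu> = "\<Sigma> *v axis i 1"
  let ?X = "\<lambda>(x, m, y). x :: real^'d" and ?M = "\<lambda>(x, m, y). m :: bool^'d" and ?Y = "\<lambda>(x, m, y). y :: real"
  obtain P :: "((real^'d) \<times> (bool^'d) \<times> real) measure" where
    lda: "lda_mcar P ?X ?M ?Y ?\<mu> (- ?\<mu>) \<Sigma>" and law: "distr P (count_space UNIV) ?M = measure_pmf \<nu>"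
    using spd by (rule lda_mcar_exists)
  obtain \<alpha> \<gamma>\<^sub>0 \<gamma> where "bayes_optimal P ?X ?M ?Y (imputed_classifier \<alpha> \<gamma>\<^sub>0 \<gamma>)"
    using opt lda law unfolding constant_imputation_optimal_def optimal_imputation_def Let_def by blast
  note on_mask = bayes_optimal_on_mask[OF spd lda classifier_imputed this]
  have M: "?M \<in> measurable P (count_space UNIV)"
    using lda by (simp add: lda_mcar_def)
  have mask: "measure P {\<omega> \<in> space P. ?M \<omega> = m} > 0" for m
  proof -
    have "?M -` {m} \<inter> space P = {\<omega> \<in> space P. ?M \<omega> = m}"
      by auto
    then show ?thesis
      using measure_distr[OF M, of "{m}"] \<nu>[of m] by (simp add: law measure_pmf_single)
  qed
  have \<mu>: "?\<mu> $ k = \<Sigma> $ k $ i" for k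
    by (simp add: matrix_vector_mult_basis column_def)
  have pick: "(\<Sum>k\<in>UNIV. (c *\<^sub>R axis k' 1) $ k * f k) = c * f k'" for c k' and f :: "'d \<Rightarrow> real"
    by (simp add: axis_component if_distrib[of "\<lambda>x. x * _"] if_distrib[of "(*) c"] cong: if_cong)
  have cont: "continuous_on UNIV (\<lambda>x :: real^'d. x $ k)" for k
    by (intro continuous_intros)
  have "\<gamma> $ j = 0"
  proof (rule ccontr)
    assume \<gamma>: "\<gamma> $ j \<noteq> 0"
    define m :: "bool^'d" where "m = (\<chi> k. False)"
    have obs: "obs m = UNIV"
      by (simp add: obs_def m_def)
    \<comment> \<open>With this \<open>t\<close> the score at \<open>x\<close> is \<open>-1\<close>, although \<open>x\<^sub>i = 1\<close>.\<close>
    define t where "t = - (\<gamma>\<^sub>0 + \<gamma> $ i + 1) / \<gamma> $ j"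
    define x :: "real^'d" where "x = axis i 1 + t *\<^sub>R axis j 1"
    let ?U = "{x. 0 < x $ i} \<inter> {x. \<gamma>\<^sub>0 + (\<Sum>k\<in>UNIV. \<gamma> $ k * x $ k) < 0}"
    have "?U = {}"
    proof (rule on_mask[OF mask, of m "2 *\<^sub>R axis i 1"])
      show "open ?U"
        by (intro open_Int open_Collect_less continuous_intros cont)
    next
      fix x assume "x \<in> ?U"
      then show "if x \<in> region (imputed_classifier \<alpha> \<gamma>\<^sub>0 \<gamma>) m
          then (\<Sum>k\<in>UNIV. (2 *\<^sub>R axis i 1) $ k * (x $ k - (?\<mu> $ k + (- ?\<mu>) $ k) / 2)) < 0
          else (\<Sum>k\<in>UNIV. (2 *\<^sub>R axis i 1) $ k * (x $ k - (?\<mu> $ k + (- ?\<mu>) $ k) / 2)) > 0"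
        unfolding pick by (simp add: region_imputed obs)
    qed (simp_all add: obs matrix_vector_mult_scaleR)
    moreover have "(\<Sum>k\<in>UNIV. \<gamma> $ k * x $ k) = \<gamma> $ i + t * \<gamma> $ j"
    proof -
      have "(\<Sum>k\<in>UNIV. \<gamma> $ k * x $ k) = \<gamma> \<bullet> x"
        by (simp add: inner_vec_def)
      then show ?thesis
        by (simp add: x_def inner_add_right inner_axis)
    qed
    then have "x \<in> ?U"
      using \<gamma> ij by (simp add: x_def t_def axis_component)
    ultimately show False
      by blast
  qed
  define m :: "bool^'d" where "m = (\<chi> k. k \<noteq> j)"
  have obs: "obs m = {j}"
    by (auto simp: obs_def m_def)
  have pos: "\<Sigma> $ j $ j > 0"
    using symmetric_positive_definiteD(2)[OF spd, of "axis j 1"]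
    by (simp add: inner_axis' matrix_vector_mult_basis column_def axis_eq_0_iff)
  \<comment> \<open>The weight of the optimal rule for the mask on which only coordinate \<open>j\<close> is observed.\<close>
  define s where "s = 2 * \<Sigma> $ j $ i / \<Sigma> $ j $ j"
  have s: "s \<noteq> 0"
    using nz pos by (simp add: s_def)
  define c where "c = \<gamma>\<^sub>0 + (\<Sum>k\<in>UNIV. \<gamma> $ k * \<alpha> $ k)"
  have region: "region (imputed_classifier \<alpha> \<gamma>\<^sub>0 \<gamma>) m = {x. 0 \<le> c}"
  proof -
    have "\<gamma> $ k * (if k \<in> obs m then x $ k else \<alpha> $ k) = \<gamma> $ k * \<alpha> $ k" for k x
      using \<open>\<gamma> $ j = 0\<close> by (auto simp: obs)
    then show ?thesis
      unfolding region_imputed c_def by (simp only:)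
  qed
  \<comment> \<open>The sign is chosen to single out the half-space on which the constant prediction is wrong.\<close>
  define \<sigma> :: real where "\<sigma> = (if 0 \<le> c then - 1 else 1)"
  have "{x. 0 < \<sigma> * (s * x $ j)} = {}"
  proof (rule on_mask[OF mask, of m "s *\<^sub>R axis j 1"])
    show "open {x. 0 < \<sigma> * (s * x $ j)}"
      by (intro open_Collect_less continuous_intros cont)
  next
    fix x assume "x \<in> {x. 0 < \<sigma> * (s * x $ j)}"
    then show "if x \<in> region (imputed_classifier \<alpha> \<gamma>\<^sub>0 \<gamma>) m
        then (\<Sum>k\<in>UNIV. (s *\<^sub>R axis j 1) $ k * (x $ k - (?\<mu> $ k + (- ?\<mu>) $ k) / 2)) < 0
        else (\<Sum>k\<in>UNIV. (s *\<^sub>R axis j 1) $ k * (x $ k - (?\<mu> $ k + (- ?\<mu>) $ k) / 2)) > 0"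
      unfolding pick by (simp add: region \<sigma>_def split: if_splits)
  next
    fix k assume "k \<in> obs m"
    then have "k = j"
      by (simp add: obs)
    then show "(\<Sigma> *v (s *\<^sub>R axis j 1)) $ k = ?\<mu> $ k - (- ?\<mu>) $ k"
      using pos by (simp add: matrix_vector_mult_scaleR matrix_vector_mult_basis column_def s_def)
  qed (simp add: obs axis_component)
  moreover have "axis j (\<sigma> * s) \<in> {x. 0 < \<sigma> * (s * x $ j)}"
    using s by (auto simp: axis_nth \<sigma>_def mult_less_0_iff zero_less_mult_iff linorder_neq_iff)
  ultimately show False
    by blast
qed

theorem proposition5p3:
  fixes \<Sigma> :: "real^'d^'d"
  assumes "CARD('d) \<ge> 3"
    and "symmetric_positive_definite \<Sigma>"
  shows "((\<forall>\<mu>\<^sub>1 \<mu>\<^sub>m\<^sub>1. constant_imputation_optimal UNIV \<mu>\<^sub>1 \<mu>\<^sub>m\<^sub>1 \<Sigma>) \<longleftrightarrow> diagonal_matrix \<Sigma>)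
    \<and> (\<forall>\<nu>. (\<forall>m. pmf \<nu> m > 0) \<longrightarrow>
         ((\<forall>\<mu>\<^sub>1 \<mu>\<^sub>m\<^sub>1. constant_imputation_optimal {\<nu>} \<mu>\<^sub>1 \<mu>\<^sub>m\<^sub>1 \<Sigma>) \<longleftrightarrow> diagonal_matrix \<Sigma>))
    \<and> (diagonal_matrix \<Sigma> \<longrightarrow>
         (\<forall>\<mu>\<^sub>1 \<mu>\<^sub>m\<^sub>1. optimal_imputation UNIV \<mu>\<^sub>1 \<mu>\<^sub>m\<^sub>1 \<Sigma> (\<chi> j. (\<mu>\<^sub>1 $ j + \<mu>\<^sub>m\<^sub>1 $ j) / 2)))"
proof -
  note spd = assms(2)
  have suff: "constant_imputation_optimal laws \<mu>\<^sub>1 \<mu>\<^sub>m\<^sub>1 \<Sigma>" if "diagonal_matrix \<Sigma>" for laws \<mu>\<^sub>1 \<mu>\<^sub>m\<^sub>1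
    using midpoint_imputation_optimal[OF spd that] unfolding constant_imputation_optimal_def by blast
  have nec: "diagonal_matrix \<Sigma>"
    if "\<And>m. pmf \<nu> m > 0" "\<And>\<mu>\<^sub>1 \<mu>\<^sub>m\<^sub>1. constant_imputation_optimal {\<nu>} \<mu>\<^sub>1 \<mu>\<^sub>m\<^sub>1 \<Sigma>" for \<nu>
    using constant_imputation_optimal_imp_uncorrelated[OF spd that(1) that(2)]
    unfolding diagonal_matrix_def by metis
  have mono: "constant_imputation_optimal {\<nu>} \<mu>\<^sub>1 \<mu>\<^sub>m\<^sub>1 \<Sigma>" if "constant_imputation_optimal UNIV \<mu>\<^sub>1 \<mu>\<^sub>m\<^sub>1 \<Sigma>" for \<nu> \<mu>\<^sub>1 \<mu>\<^sub>m\<^sub>1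
    using that unfolding constant_imputation_optimal_def optimal_imputation_def by blast
  have "pmf (pmf_of_set (UNIV :: (bool^'d) set)) m > 0" for m
    by (simp add: pmf_of_set)
  then have "diagonal_matrix \<Sigma>" if "\<And>\<mu>\<^sub>1 \<mu>\<^sub>m\<^sub>1. constant_imputation_optimal UNIV \<mu>\<^sub>1 \<mu>\<^sub>m\<^sub>1 \<Sigma>"
    using nec[of "pmf_of_set UNIV"] mono[OF that] by blast
  then show ?thesis
    using suff nec midpoint_imputation_optimal[OF spd] by blast
qed

end
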